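(* Let $\mathscr{X}$ be a countable (non-empty) set, and let $(\overline{E}_U)_{U\in\mathscr{U}}$ be a consistent collection of finite-dimensional upper expectations that are downward continuous (that is, each $\overline{E}_U$ is downward continuous). Suppose that for all $n\in\mathbb{N}$ there is some $\lambda_n\in\mathbb{R}_{\ge0}$ such that $$\limsup_{s\to t}\frac{\overline{E}_{\{s,t\}}\big(d_{\{s,t\}}^{\neq}\big)}{|s-t|}\le\lambda_n\quad\text{for all }t\in[0,n].$$ Then the corresponding upper expectation $\overline{E}$ on $\mathscr{D}$, i.e. the unique upper expectation on $\mathscr{D}$ such that $\overline{E}(f\circ\pi_U)=\overline{E}_U(f)$ for all $U\in\mathscr{U}$ and $f\in\mathcal{L}(\mathscr{X}^U)$, is downward continuous.
   Context: $\mathcal{L}(\mathcal{Y})$ is the set of bounded real-valued functions on a set $\mathcal{Y}$. An upper expectation on a linear space $\mathcal{G}$ of real functions that contains all constants is a functional $\Phi$ on $\mathcal{G}$ that is isotone ($f\le g$ implies $\Phi(f)\le\Phi(g)$), constant preserving ($\Phi(\mu)=\mu$ for all $\mu\in\mathbb{R}$), subadditive and positively homogeneous ($\Phi(\mu f)=\mu\Phi(f)$ for real $\mu\ge0$). It is downward continuous if $\lim_n\Phi(f_n)=\Phi(f)$ for every (pointwise) decreasing sequence $(f_n)_{n\in\mathbb{N}}$ in $\mathcal{G}$ whose pointwise limit $f$ is in $\mathcal{G}$. $\Omega\subseteq\mathscr{X}^{\mathbb{R}_{\ge0}}$ is the set of càdlàg paths, i.e. maps $\omega\colon\mathbb{R}_{\ge0}\to\mathscr{X}$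 that are right-continuous and have left-sided limits, with $\mathscr{X}$ carrying the discrete topology. $\mathscr{U}$ is the set of all non-empty finite subsets of $\mathbb{R}_{\ge0}$. For $U\subseteq V\subseteq\mathbb{R}_{\ge0}$, $\pi_U^V\colon\mathscr{X}^V\to\mathscr{X}^U$ is the restriction map, and $\pi_U\colon\Omega\to\mathscr{X}^U$ maps a path to its restriction to $U$. $\mathscr{D}\coloneqq\{f\circ\pi_U\colon U\in\mathscr{U},\ f\in\mathcal{L}(\mathscr{X}^U)\}\subseteq\mathcal{L}(\Omega)$, the linear space of finitary bounded functions. A collection of finite-dimensional upper expectations is a collection $(\overline{E}_U)_{U\in\mathscr{U}}$ where each $\overline{E}_U$ is an upper expectation on $\mathcal{L}(\mathscr{X}^U)$. It is consistent if for all $U,V\in\mathscr{U}$ with $U\subseteq V$, $\overline{E}_U(f)=\overline{E}_V(f\circ\pi_U^V)$ for all $f\in\mathcal{L}(\mathscr{X}^U)$. For a consistent collection, there is a unique upper expectation $\overline{E}$ on $\mathscr{D}$ with $\overline{E}(f\circ\pi_U)=\overline{E}_U(f)$ for all $U\in\mathscr{U}$, $f\in\mathcal{L}(\mathscr{X}^U)$. For distinct $t_1,t_2\in\mathbb{R}_{\ge0}$ and $U=\{t_1,t_2\}$, $d_U^{\neq}\in\mathcal{L}(\mathscr{X}^U)$ is given by $d_U^{\neq}(x)=1$ if $x(t_1)\ne x(t_2)$ and $d_U^{\neq}(x)=0$ otherwise. The limit superior is over $s\in\mathbb{R}_{\ge0}\setminus\{t\}$. *)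

theory Defs
  imports "HOL-Analysis.Analysis"
begin

section \<open>Upper expectations\<close>

text \<open>
  A real function on a set \<open>Y\<close> is an element of \<^term>\<open>extensional Y\<close>, so that
  two functions on \<open>Y\<close> are equal in HOL iff they agree on \<open>Y\<close>.
\<close>

definition bounded_funs :: "'y set \<Rightarrow> ('y \<Rightarrow> real) set" where
  "bounded_funs Y = {f \<in> extensional Y. bounded (f ` Y)}"

definition linear_space_with_constants :: "'y set \<Rightarrow> ('y \<Rightarrow> real) set \<Rightarrow> bool" where
  "linear_space_with_constants Y G \<longleftrightarrow>
     G \<subseteq> extensional Y \<and>
     (\<forall>c. (\<lambda>y\<in>Y. c) \<in> G) \<and>
     (\<forall>f\<in>G. \<forall>g\<in>G. (\<lambda>y\<in>Y. f y + g y) \<in> G) \<and>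
     (\<forall>f\<in>G. \<forall>c. (\<lambda>y\<in>Y. c * f y) \<in> G)"

text \<open>Only the values of \<open>\<Phi>\<close> on \<open>G\<close> are relevant in the following two notions.\<close>

definition upper_expectation ::
    "'y set \<Rightarrow> ('y \<Rightarrow> real) set \<Rightarrow> (('y \<Rightarrow> real) \<Rightarrow> real) \<Rightarrow> bool" where
  "upper_expectation Y G \<Phi> \<longleftrightarrow>
     linear_space_with_constants Y G \<and>
     (\<forall>f\<in>G. \<forall>g\<in>G. (\<forall>y\<in>Y. f y \<le> g y) \<longrightarrow> \<Phi> f \<le> \<Phi> g) \<and>
     (\<forall>c. \<Phi> (\<lambda>y\<in>Y. c) = c) \<and>
     (\<forall>f\<in>G. \<forall>g\<in>G. \<Phi> (\<lambda>y\<in>Y. f y + g y) \<le> \<Phi> f + \<Phi> g) \<and>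
     (\<forall>f\<in>G. \<forall>c\<ge>0. \<Phi> (\<lambda>y\<in>Y. c * f y) = c * \<Phi> f)"

definition downward_continuous ::
    "'y set \<Rightarrow> ('y \<Rightarrow> real) set \<Rightarrow> (('y \<Rightarrow> real) \<Rightarrow> real) \<Rightarrow> bool" where
  "downward_continuous Y G \<Phi> \<longleftrightarrow>
     (\<forall>F f. (\<forall>n. F n \<in> G) \<and> f \<in> G \<and>
            (\<forall>y\<in>Y. decseq (\<lambda>n. F n y) \<and> (\<lambda>n. F n y) \<longlonglongrightarrow> f y)
        \<longrightarrow> (\<lambda>n. \<Phi> (F n)) \<longlonglongrightarrow> \<Phi> f)"


section \<open>Paths and finite-dimensional upper expectations\<close>

definition cadlag_paths :: "'x set \<Rightarrow> (real \<Rightarrow> 'x) set" where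
  "cadlag_paths X = {\<omega> \<in> {0..} \<rightarrow>\<^sub>E X.
     (\<forall>t\<ge>0. limitin (discrete_topology X) \<omega> (\<omega> t) (at_right t)) \<and>
     (\<forall>t>0. \<exists>l. limitin (discrete_topology X) \<omega> l (at_left t))}"

definition time_sets :: "real set set" where
  "time_sets = {U. finite U \<and> U \<noteq> {} \<and> U \<subseteq> {0..}}"

text \<open>
  The restriction maps \<open>\<pi>\<^sub>U\<close> and \<open>\<pi>\<^sub>U\<^sup>V\<close> are \<open>\<lambda>x. restrict x U\<close>, and
  \<^term>\<open>compose A f (\<lambda>x. restrict x U)\<close> is the composition of \<open>f\<close> with this map on the domain \<open>A\<close>.
\<close>

definition finitary_funs :: "'x set \<Rightarrow> ((real \<Rightarrow> 'x) \<Rightarrow> real) set" where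
  "finitary_funs X =
     {compose (cadlag_paths X) f (\<lambda>\<omega>. restrict \<omega> U) |U f.
        U \<in> time_sets \<and> f \<in> bounded_funs (U \<rightarrow>\<^sub>E X)}"

definition fd_upper_expectations ::
    "'x set \<Rightarrow> (real set \<Rightarrow> ((real \<Rightarrow> 'x) \<Rightarrow> real) \<Rightarrow> real) \<Rightarrow> bool" where
  "fd_upper_expectations X EU \<longleftrightarrow>
     (\<forall>U\<in>time_sets. upper_expectation (U \<rightarrow>\<^sub>E X) (bounded_funs (U \<rightarrow>\<^sub>E X)) (EU U))"

definition consistent ::
    "'x set \<Rightarrow> (real set \<Rightarrow> ((real \<Rightarrow> 'x) \<Rightarrow> real) \<Rightarrow> real) \<Rightarrow> bool" where
  "consistent X EU \<longleftrightarrow>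
     (\<forall>U\<in>time_sets. \<forall>V\<in>time_sets. U \<subseteq> V \<longrightarrow>
        (\<forall>f\<in>bounded_funs (U \<rightarrow>\<^sub>E X).
           EU U f = EU V (compose (V \<rightarrow>\<^sub>E X) f (\<lambda>x. restrict x U))))"

definition corresponding_upper_expectation ::
    "'x set \<Rightarrow> (real set \<Rightarrow> ((real \<Rightarrow> 'x) \<Rightarrow> real) \<Rightarrow> real) \<Rightarrow> (((real \<Rightarrow> 'x) \<Rightarrow> real) \<Rightarrow> real) \<Rightarrow> bool"
  where
  "corresponding_upper_expectation X EU E \<longleftrightarrow>
     upper_expectation (cadlag_paths X) (finitary_funs X) E \<and>
     (\<forall>U\<in>time_sets. \<forall>f\<in>bounded_funs (U \<rightarrow>\<^sub>E X).
        E (compose (cadlag_paths X) f (\<lambda>\<omega>. restrict \<omega> U)) = EU U f)"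

definition neq_indicator :: "'x set \<Rightarrow> real \<Rightarrow> real \<Rightarrow> (real \<Rightarrow> 'x) \<Rightarrow> real" where
  "neq_indicator X s t = (\<lambda>x\<in>{s, t} \<rightarrow>\<^sub>E X. if x s \<noteq> x t then 1 else 0)"


section \<open>Existence and uniqueness of the corresponding upper expectation\<close>

lemma time_sets_Un: "U \<in> time_sets \<Longrightarrow> V \<in> time_sets \<Longrightarrow> U \<union> V \<in> time_sets"
  by (auto simp: time_sets_def)

lemma restrict_path_in:
  "\<omega> \<in> cadlag_paths X \<Longrightarrow> U \<in> time_sets \<Longrightarrow> restrict \<omega> U \<in> U \<rightarrow>\<^sub>E X"
  by (auto simp: cadlag_paths_def time_sets_def)

lemma restrict_PiE_in: "x \<in> V \<rightarrow>\<^sub>E X \<Longrightarrow> U \<subseteq> V \<Longrightarrow> restrict x U \<in> U \<rightarrow>\<^sub>E X"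
  by auto

lemma bounded_funs_compose:
  assumes "f \<in> bounded_funs Y" "\<And>z. z \<in> Z \<Longrightarrow> p z \<in> Y"
  shows "compose Z f p \<in> bounded_funs Z"
proof -
  have "compose Z f p ` Z \<subseteq> f ` Y"
    using assms(2) by (auto simp: compose_def)
  then show ?thesis
    using assms(1) by (auto simp: bounded_funs_def compose_def intro: bounded_subset)
qed

lemma linear_space_bounded_funs: "linear_space_with_constants Y (bounded_funs Y)"
proof -
  have "bounded ((\<lambda>y\<in>Y. c) ` Y)" for c :: real
    by (rule bounded_subset[of "{c}"]) auto
  moreover have "bounded ((\<lambda>y\<in>Y. f y + g y) ` Y)"
    if "bounded (f ` Y)" "bounded (g ` Y)" for f g :: "'a \<Rightarrow> real"
  proof -
    have "(\<lambda>y\<in>Y. f y + g y) ` Y = (\<lambda>y. f y + g y) ` Y" by auto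
    then show ?thesis using bounded_plus_comp[OF that] by simp
  qed
  moreover have "bounded ((\<lambda>y\<in>Y. c * f y) ` Y)"
    if "bounded (f ` Y)" for f :: "'a \<Rightarrow> real" and c
  proof -
    have "(\<lambda>y\<in>Y. c * f y) ` Y = (\<lambda>r. c *\<^sub>R r) ` f ` Y" by (auto simp: image_image)
    then show ?thesis using bounded_scaling[OF that, of c] by simp
  qed
  ultimately show ?thesis
    by (auto simp: linear_space_with_constants_def bounded_funs_def)
qed

lemma step_path_exists:
  assumes U: "U \<in> time_sets" and x: "x \<in> U \<rightarrow>\<^sub>E X"
  obtains \<omega> where "\<omega> \<in> cadlag_paths X" "restrict \<omega> U = x"
proof -
  define h where "h A = (if A = {} then Min U else Max A)" for A :: "real set"
  define \<omega> where "\<omega> = (\<lambda>t\<in>{0..}. x (h {u \<in> U. u \<le> t}))"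
  have fin: "finite U" "U \<noteq> {}" "U \<subseteq> {0..}" using U by (auto simp: time_sets_def)
  have h_in: "h A \<in> U" if "A \<subseteq> U" for A
    using that fin Max_in[of A] Min_in[of U] finite_subset[of A U]
    by (cases "A = {}") (simp_all add: h_def subset_iff)
  have xh: "x (h A) \<in> X" if "A \<subseteq> U" for A
    using h_in[OF that] x by auto
  have h_self: "h {u \<in> U. u \<le> t} = t" if "t \<in> U" for t
    using that fin by (auto simp: h_def intro!: Max_eqI)
  have "restrict \<omega> U = x"
  proof
    fix t show "restrict \<omega> U t = x t"
      using h_self[of t] fin(3) x by (cases "t \<in> U") (auto simp: \<omega>_def)
  qed
  moreover have "\<omega> \<in> {0..} \<rightarrow>\<^sub>E X" using xh by (auto simp: \<omega>_def)
  moreover have "limitin (discrete_topology X) \<omega> (\<omega> t) (at_right t)" if "t \<ge> 0" for t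
  proof -
    have "eventually (\<lambda>s. s > t \<and> (\<forall>u\<in>U. u \<le> s \<longleftrightarrow> u \<le> t)) (at_right t)"
    proof (intro eventually_conj eventually_ball_finite fin(1) ballI)
      show "eventually (\<lambda>s. s > t) (at_right t)" by (rule eventually_at_right_less)
      fix u assume "u \<in> U"
      show "eventually (\<lambda>s. u \<le> s \<longleftrightarrow> u \<le> t) (at_right t)"
      proof (cases "u \<le> t")
        case True
        then show ?thesis
          by (auto intro: eventually_mono[OF eventually_at_right_less])
      next
        case False
        then show ?thesis
          by (auto simp: eventually_at_right_field intro!: exI[of _ u])
      qed
    qed
    then have "eventually (\<lambda>s. \<omega> s = \<omega> t) (at_right t)"
    proof (rule eventually_mono)
      fix s assume *: "s > t \<and> (\<forall>u\<in>U. u \<le> s \<longleftrightarrow> u \<le> t)"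
      then have "{u \<in> U. u \<le> s} = {u \<in> U. u \<le> t}" by auto
      then show "\<omega> s = \<omega> t" using * that by (simp add: \<omega>_def)
    qed
    then show ?thesis
      using xh that by (auto simp: limitin_def \<omega>_def elim!: eventually_mono)
  qed
  moreover have "\<exists>l. limitin (discrete_topology X) \<omega> l (at_left t)" if "t > 0" for t
  proof -
    have "eventually (\<lambda>s. s > 0 \<and> (\<forall>u\<in>U. u \<le> s \<longleftrightarrow> u < t)) (at_left t)"
    proof (intro eventually_conj eventually_ball_finite fin(1) ballI)
      show "eventually (\<lambda>s. s > 0) (at_left t)"
        using that by (auto simp: eventually_at_left_field)
      fix u assume "u \<in> U"
      show "eventually (\<lambda>s. u \<le> s \<longleftrightarrow> u < t) (at_left t)"
      proof (cases "u < t")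
        case True
        then show ?thesis
          by (auto simp: eventually_at_left_field intro!: exI[of _ u])
      next
        case False
        then show ?thesis
          by (auto simp: eventually_at_left_field intro!: exI[of _ "t - 1"])
      qed
    qed
    then have "eventually (\<lambda>s. \<omega> s = x (h {u \<in> U. u < t})) (at_left t)"
    proof (rule eventually_mono)
      fix s assume *: "s > 0 \<and> (\<forall>u\<in>U. u \<le> s \<longleftrightarrow> u < t)"
      then have "{u \<in> U. u \<le> s} = {u \<in> U. u < t}" by auto
      then show "\<omega> s = x (h {u \<in> U. u < t})" using * by (simp add: \<omega>_def)
    qed
    then have "limitin (discrete_topology X) \<omega> (x (h {u \<in> U. u < t})) (at_left t)"
      using xh by (auto simp: limitin_def elim!: eventually_mono)
    then show ?thesis ..
  qed
  ultimately show thesis using that[of \<omega>] by (simp add: cadlag_paths_def)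
qed

lemma finitary_funs_common:
  assumes "g \<in> finitary_funs X" "g' \<in> finitary_funs X"
  obtains W f f' where "W \<in> time_sets" "f \<in> bounded_funs (W \<rightarrow>\<^sub>E X)" "f' \<in> bounded_funs (W \<rightarrow>\<^sub>E X)"
    "g = compose (cadlag_paths X) f (\<lambda>\<omega>. restrict \<omega> W)"
    "g' = compose (cadlag_paths X) f' (\<lambda>\<omega>. restrict \<omega> W)"
proof -
  obtain U f where U: "U \<in> time_sets" "f \<in> bounded_funs (U \<rightarrow>\<^sub>E X)"
      "g = compose (cadlag_paths X) f (\<lambda>\<omega>. restrict \<omega> U)"
    using assms(1) by (auto simp: finitary_funs_def)
  obtain V f' where V: "V \<in> time_sets" "f' \<in> bounded_funs (V \<rightarrow>\<^sub>E X)"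
      "g' = compose (cadlag_paths X) f' (\<lambda>\<omega>. restrict \<omega> V)"
    using assms(2) by (auto simp: finitary_funs_def)
  let ?W = "U \<union> V"
  have W: "?W \<in> time_sets" using U V by (blast intro: time_sets_Un)
  have lift: "compose (cadlag_paths X) (compose (?W \<rightarrow>\<^sub>E X) k (\<lambda>x. restrict x A)) (\<lambda>\<omega>. restrict \<omega> ?W)
      = compose (cadlag_paths X) k (\<lambda>\<omega>. restrict \<omega> A)" if "A \<subseteq> ?W"
    for A and k :: "(real \<Rightarrow> 'a) \<Rightarrow> real"
    using restrict_path_in[OF _ W] that
    by (auto simp: compose_def fun_eq_iff restrict_restrict Int_absorb1)
  show thesis
    by (rule that[OF W, of "compose (?W \<rightarrow>\<^sub>E X) f (\<lambda>x. restrict x U)"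
                      "compose (?W \<rightarrow>\<^sub>E X) f' (\<lambda>x. restrict x V)"])
      (use U V in \<open>auto simp: lift intro!: bounded_funs_compose restrict_PiE_in\<close>)
qed

lemma linear_space_finitary_funs:
  "linear_space_with_constants (cadlag_paths X) (finitary_funs X)"
proof -
  let ?P = "cadlag_paths X"
  have mem: "(\<lambda>\<omega>\<in>?P. f (restrict \<omega> U)) \<in> finitary_funs X"
    if "U \<in> time_sets" "restrict f (U \<rightarrow>\<^sub>E X) \<in> bounded_funs (U \<rightarrow>\<^sub>E X)" for U f
  proof -
    have "(\<lambda>\<omega>\<in>?P. f (restrict \<omega> U)) = compose ?P (restrict f (U \<rightarrow>\<^sub>E X)) (\<lambda>\<omega>. restrict \<omega> U)"
      using restrict_path_in[OF _ that(1)] by (auto simp: compose_def fun_eq_iff)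
    then show ?thesis using that by (auto simp: finitary_funs_def)
  qed
  note lin = linear_space_bounded_funs[unfolded linear_space_with_constants_def]
  have t0: "{0} \<in> time_sets" by (simp add: time_sets_def)
  have "finitary_funs X \<subseteq> extensional ?P" by (auto simp: finitary_funs_def)
  moreover have "(\<lambda>\<omega>\<in>?P. c) \<in> finitary_funs X" for c
    using mem[OF t0, of "\<lambda>_. c"] lin by blast
  moreover have "(\<lambda>\<omega>\<in>?P. g \<omega> + g' \<omega>) \<in> finitary_funs X"
    if gg: "g \<in> finitary_funs X" "g' \<in> finitary_funs X" for g g'
  proof -
    obtain W f f' where W: "W \<in> time_sets" "f \<in> bounded_funs (W \<rightarrow>\<^sub>E X)"
        "f' \<in> bounded_funs (W \<rightarrow>\<^sub>E X)"
      and eq: "g = compose ?P f (\<lambda>\<omega>. restrict \<omega> W)" "g' = compose ?P f' (\<lambda>\<omega>. restrict \<omega> W)"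
      by (rule finitary_funs_common[OF gg])
    have "(\<lambda>\<omega>\<in>?P. g \<omega> + g' \<omega>) = (\<lambda>\<omega>\<in>?P. f (restrict \<omega> W) + f' (restrict \<omega> W))"
      by (auto simp: eq compose_def fun_eq_iff)
    then show ?thesis using mem[OF W(1), of "\<lambda>x. f x + f' x"] W lin by metis
  qed
  moreover have "(\<lambda>\<omega>\<in>?P. c * g \<omega>) \<in> finitary_funs X"
    if gg: "g \<in> finitary_funs X" for g c
  proof -
    obtain W f where W: "W \<in> time_sets" "f \<in> bounded_funs (W \<rightarrow>\<^sub>E X)"
      and eq: "g = compose ?P f (\<lambda>\<omega>. restrict \<omega> W)"
      using gg by (auto simp: finitary_funs_def)
    have "(\<lambda>\<omega>\<in>?P. c * g \<omega>) = (\<lambda>\<omega>\<in>?P. c * f (restrict \<omega> W))"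
      by (auto simp: eq compose_def fun_eq_iff)
    then show ?thesis using mem[OF W(1), of "\<lambda>x. c * f x"] W lin by metis
  qed
  ultimately show ?thesis unfolding linear_space_with_constants_def by blast
qed

lemma corresponding_upper_expectation_unique:
  assumes "corresponding_upper_expectation X EU E" "corresponding_upper_expectation X EU E'"
    "g \<in> finitary_funs X"
  shows "E g = E' g"
  using assms by (auto simp: corresponding_upper_expectation_def finitary_funs_def)

lemma corresponding_upper_expectation_exists:
  assumes fd: "fd_upper_expectations X EU" and cons: "consistent X EU"
  shows "\<exists>E. corresponding_upper_expectation X EU E"
proof -
  let ?P = "cadlag_paths X"
  let ?c = "\<lambda>U f. compose ?P f (\<lambda>\<omega>. restrict \<omega> U)"
  let ?L = "\<lambda>U. bounded_funs (U \<rightarrow>\<^sub>E X)"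
  have ue: "upper_expectation (U \<rightarrow>\<^sub>E X) (?L U) (EU U)" if "U \<in> time_sets" for U
    using fd that by (auto simp: fd_upper_expectations_def)
  have le: "EU U f \<le> EU V f'"
    if U: "U \<in> time_sets" "f \<in> ?L U" and V: "V \<in> time_sets" "f' \<in> ?L V"
      and fle: "\<And>\<omega>. \<omega> \<in> ?P \<Longrightarrow> ?c U f \<omega> \<le> ?c V f' \<omega>" for U V f f'
  proof -
    let ?W = "U \<union> V"
    let ?f = "compose (?W \<rightarrow>\<^sub>E X) f (\<lambda>x. restrict x U)"
    let ?f' = "compose (?W \<rightarrow>\<^sub>E X) f' (\<lambda>x. restrict x V)"
    have W: "?W \<in> time_sets" using U V by (blast intro: time_sets_Un)
    have "?f x \<le> ?f' x" if x: "x \<in> ?W \<rightarrow>\<^sub>E X" for x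
    proof -
      obtain \<omega> where \<omega>: "\<omega> \<in> ?P" "restrict \<omega> ?W = x" using step_path_exists[OF W x] .
      have "restrict x U = restrict \<omega> U" "restrict x V = restrict \<omega> V"
        by (auto simp flip: \<omega>(2))
      then show ?thesis using fle[OF \<omega>(1)] \<omega>(1) x by (simp add: compose_def)
    qed
    moreover have "?f \<in> ?L ?W" "?f' \<in> ?L ?W"
      using U V by (auto intro!: bounded_funs_compose restrict_PiE_in)
    ultimately have "EU ?W ?f \<le> EU ?W ?f'"
      using ue[OF W] unfolding upper_expectation_def by blast
    then show ?thesis using cons U V W unfolding consistent_def by (metis Un_upper1 Un_upper2)
  qed
  define E where "E g = (SOME r. \<exists>U f. U \<in> time_sets \<and> f \<in> ?L U \<and> g = ?c U f \<and> r = EU U f)" for g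
  have E: "E (?c U f) = EU U f" if "U \<in> time_sets" "f \<in> ?L U" for U f
    unfolding E_def
  proof (rule some_equality)
    show "\<exists>V f'. V \<in> time_sets \<and> f' \<in> ?L V \<and> ?c U f = ?c V f' \<and> EU U f = EU V f'"
      using that by blast
    fix r assume "\<exists>V f'. V \<in> time_sets \<and> f' \<in> ?L V \<and> ?c U f = ?c V f' \<and> r = EU V f'"
    then obtain V f' where V: "V \<in> time_sets" "f' \<in> ?L V" "?c U f = ?c V f'" "r = EU V f'"
      by blast
    have "EU U f \<le> EU V f'" using le[OF that V(1,2)] V(3) by simp
    moreover have "EU V f' \<le> EU U f" using le[OF V(1,2) that] V(3) by simp
    ultimately show "r = EU U f" using V(4) by simp
  qed
  have pull: "(\<lambda>\<omega>\<in>?P. k (restrict \<omega> U)) = ?c U (restrict k (U \<rightarrow>\<^sub>E X))"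
    if "U \<in> time_sets" for U and k :: "(real \<Rightarrow> 'a) \<Rightarrow> real"
    using restrict_path_in[OF _ that] by (auto simp: compose_def fun_eq_iff)
  note lin = linear_space_bounded_funs[unfolded linear_space_with_constants_def]
  have "upper_expectation ?P (finitary_funs X) E"
    unfolding upper_expectation_def
  proof (intro conjI ballI allI impI)
    show "linear_space_with_constants ?P (finitary_funs X)" by (rule linear_space_finitary_funs)
  next
    fix g g' assume gg: "g \<in> finitary_funs X" "g' \<in> finitary_funs X" and "\<forall>\<omega>\<in>?P. g \<omega> \<le> g' \<omega>"
    then show "E g \<le> E g'" by (auto simp: finitary_funs_def E intro!: le)
  next
    fix c :: real
    have t0: "{0} \<in> time_sets" by (simp add: time_sets_def)
    have "E (\<lambda>\<omega>\<in>?P. c) = EU {0} (\<lambda>x\<in>{0} \<rightarrow>\<^sub>E X. c)"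
      using pull[OF t0, of "\<lambda>_. c"] E[OF t0] lin by metis
    then show "E (\<lambda>\<omega>\<in>?P. c) = c" using ue[OF t0] by (auto simp: upper_expectation_def)
  next
    fix g g' assume gg: "g \<in> finitary_funs X" "g' \<in> finitary_funs X"
    obtain W f f' where W: "W \<in> time_sets" "f \<in> ?L W" "f' \<in> ?L W"
      and eq: "g = ?c W f" "g' = ?c W f'"
      by (rule finitary_funs_common[OF gg])
    have "(\<lambda>\<omega>\<in>?P. g \<omega> + g' \<omega>) = (\<lambda>\<omega>\<in>?P. f (restrict \<omega> W) + f' (restrict \<omega> W))"
      by (auto simp: eq compose_def fun_eq_iff)
    also have "\<dots> = ?c W (\<lambda>x\<in>W \<rightarrow>\<^sub>E X. f x + f' x)" by (rule pull[OF W(1)])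
    finally have "E (\<lambda>\<omega>\<in>?P. g \<omega> + g' \<omega>) = EU W (\<lambda>x\<in>W \<rightarrow>\<^sub>E X. f x + f' x)"
      using E[OF W(1)] W lin by metis
    also have "\<dots> \<le> EU W f + EU W f'" using ue[OF W(1)] W by (auto simp: upper_expectation_def)
    finally show "E (\<lambda>\<omega>\<in>?P. g \<omega> + g' \<omega>) \<le> E g + E g'" using E W by (simp add: eq)
  next
    fix g and c :: real assume gg: "g \<in> finitary_funs X" and c: "0 \<le> c"
    obtain W f where W: "W \<in> time_sets" "f \<in> ?L W" and eq: "g = ?c W f"
      using gg by (auto simp: finitary_funs_def)
    have "(\<lambda>\<omega>\<in>?P. c * g \<omega>) = (\<lambda>\<omega>\<in>?P. c * f (restrict \<omega> W))"
      by (auto simp: eq compose_def fun_eq_iff)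
    also have "\<dots> = ?c W (\<lambda>x\<in>W \<rightarrow>\<^sub>E X. c * f x)" by (rule pull[OF W(1)])
    finally have "E (\<lambda>\<omega>\<in>?P. c * g \<omega>) = EU W (\<lambda>x\<in>W \<rightarrow>\<^sub>E X. c * f x)"
      using E[OF W(1)] W lin by metis
    also have "\<dots> = c * EU W f" using ue[OF W(1)] W c by (auto simp: upper_expectation_def)
    finally show "E (\<lambda>\<omega>\<in>?P. c * g \<omega>) = c * E g" using E W by (simp add: eq)
  qed
  then show ?thesis using E by (auto simp: corresponding_upper_expectation_def)
qed

end

theory Submission
  imports Defs "HOL-Library.Diagonal_Subsequence"
begin

text \<open>
  By subadditivity it suffices that \<open>E g\<^sub>n \<rightarrow> 0\<close> whenever \<open>g\<^sub>n\<close> decreases to \<open>0\<close> on the path space.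
  The functional \<open>(s, t) \<mapsto> E (\<omega> s \<noteq> \<omega> t)\<close> is a pseudometric, so the pointwise rate bound makes it
  Lipschitz on bounded intervals; hence the upper expected number of jumps along any finite
  time set in an interval is bounded by a multiple of the length of that interval.

  If \<open>E g\<^sub>n \<ge> \<epsilon>\<close> for all \<open>n\<close>, subtract from \<open>g\<^sub>n\<close> finitely many penalties with total upper expectation
  below \<open>\<epsilon>\<close>. They charge a path for leaving a finite set of states at a time, for jumping shortly
  after a time, and for jumping often on a bounded interval. There is then a path \<open>\<omega>\<^sub>n\<close> at which
  \<open>g\<^sub>n\<close> exceeds \<open>\<epsilon> / 4\<close> plus all penalties. A diagonal subsequence of \<open>\<omega>\<^sub>n\<close> is eventually constant at each
  time of a countable dense set, and the penalties make its limit extend to a cadlag path, at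
  which no \<open>g\<^sub>n\<close> is below \<open>\<epsilon> / 4\<close>.
\<close>

section \<open>Jumps and cadlag extensions\<close>

fun jumps :: "('a \<Rightarrow> 'b) \<Rightarrow> 'a list \<Rightarrow> nat" where
  "jumps x [] = 0"
| "jumps x [u] = 0"
| "jumps x (u # v # l) = of_bool (x u \<noteq> x v) + jumps x (v # l)"

lemma jumps_cong: "(\<And>u. u \<in> set l \<Longrightarrow> x u = y u) \<Longrightarrow> jumps x l = jumps y l"
  by (induction x l rule: jumps.induct) auto

lemma jumps_le_length: "jumps x l \<le> length l"
  by (induction x l rule: jumps.induct) auto

lemma jumps_Cons_ge: "jumps x l \<le> jumps x (u # l)"
  by (cases l) auto

lemma jumps_triangle: "jumps x (u # l) \<le> of_bool (x u \<noteq> x v) + jumps x (v # l)"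
  by (cases l) auto

text \<open>Removing an entry merges two consecutive comparisons into one, which cannot add a jump
  because \<open>\<noteq>\<close> satisfies a triangle inequality. The auxiliary claim keeps a head
  \<open>w\<close> that survives the filter, so that each removed entry has a left neighbour to
  compare with.\<close>

lemma jumps_filter: "jumps x (filter P l) \<le> jumps x l"
proof -
  have *: "jumps x (w # filter P l) \<le> jumps x (w # l)" for w l
  proof (induction l arbitrary: w)
    case (Cons v l)
    show ?case
      using jumps_triangle[of x w "filter P l" v] Cons.IH[of v] by simp
  qed simp
  show ?thesis
  proof (induction l)
    case (Cons v l)
    show ?case using *[of v l] jumps_Cons_ge[of x l v] Cons.IH by simp
  qed simp
qed

lemma jumps_append_ge: "jumps x k + jumps x l \<le> jumps x (k @ l)"
proof (induction x k rule: jumps.induct)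
  case (2 x u)
  then show ?case using jumps_Cons_ge[of x l u] by simp
qed simp_all

text \<open>A strictly sorted list is determined by its set of entries, so \<open>l\<close> is a
  filtered version of the list of \<open>W\<close>. Thus a bound along all enumerated times controls
  every coarser choice of times.\<close>

lemma jumps_mono:
  fixes l :: "'a :: linorder list"
  assumes "finite W" "set l \<subseteq> W" "sorted_wrt (<) l"
  shows "jumps x l \<le> jumps x (sorted_list_of_set W)"
proof -
  have "l = filter (\<lambda>u. u \<in> set l) (sorted_list_of_set W)"
    using assms by (intro strict_sorted_equal) (auto intro: sorted_wrt_filter)
  then show ?thesis by (metis jumps_filter)
qed

text \<open>Since the jump counts are bounded, some list attains the largest one. Two times with
  different values lying before or after that whole list could be prepended or appended and would
  give one more jump.\<close>

lemma constant_near_endpoints: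
  fixes x :: "real \<Rightarrow> 'a"
  assumes "a < b"
    and bdd: "\<And>l. set l \<subseteq> T \<inter> {a<..<b} \<Longrightarrow> sorted_wrt (<) l \<Longrightarrow> jumps x l \<le> B"
  obtains c d where "a < c" "a < d" "c < b" "d < b"
    "\<And>u v. u \<in> T \<inter> {a<..<c} \<Longrightarrow> v \<in> T \<inter> {a<..<c} \<Longrightarrow> x u = x v"
    "\<And>u v. u \<in> T \<inter> {d<..<b} \<Longrightarrow> v \<in> T \<inter> {d<..<b} \<Longrightarrow> x u = x v"
proof -
  let ?L = "\<lambda>l. set l \<subseteq> T \<inter> {a<..<b} \<and> sorted_wrt (<) l"
  have "\<exists>l. ?L l \<and> (\<forall>k. ?L k \<longrightarrow> jumps x k \<le> jumps x l)"
    by (rule ex_has_greatest_nat[of _ "[]" _ "Suc B"]) (use bdd in \<open>auto simp: less_Suc_eq_le\<close>)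
  then obtain l where l: "?L l" and max: "\<And>k. ?L k \<Longrightarrow> jumps x k \<le> jumps x l"
    by blast
  \<comment> \<open>Including the midpoint makes the minimum and maximum meaningful for an empty
    list and ensures \<open>c < b\<close> and \<open>a < d\<close>.\<close>
  define c where "c = Min (insert ((a + b) / 2) (set l))"
  define d where "d = Max (insert ((a + b) / 2) (set l))"
  have c: "c \<le> u" and d: "u \<le> d" if "u \<in> set l" for u
    using that by (auto simp: c_def d_def)
  show thesis
  proof
    show "a < c" "a < d" "c < b" "d < b"
      using l assms(1) by (auto simp: c_def d_def Max_gr_iff Min_less_iff)
    have *: "x u = x v" if "u \<in> T \<inter> {a<..<c}" "v \<in> T \<inter> {a<..<c}" "u < v" for u v
    proof (rule ccontr)
      assume neq: "x u \<noteq> x v"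
      have "jumps x [u, v] + jumps x l \<le> jumps x ([u, v] @ l)" by (rule jumps_append_ge)
      moreover have "set ([u, v] @ l) \<subseteq> T \<inter> {a<..<b}" using l that(1,2) \<open>c < b\<close> by simp
      moreover have "\<forall>w\<in>set l. v < w" using that(2) c by fastforce
      then have "sorted_wrt (<) ([u, v] @ l)" using l that(3) by (simp add: sorted_wrt_append) (meson less_trans)
      ultimately show False using max[of "[u, v] @ l"] neq by simp
    qed
    then show "x u = x v" if "u \<in> T \<inter> {a<..<c}" "v \<in> T \<inter> {a<..<c}" for u v
      using that by (metis linorder_neq_iff)
    have *: "x u = x v" if "u \<in> T \<inter> {d<..<b}" "v \<in> T \<inter> {d<..<b}" "u < v" for u v
    proof (rule ccontr)
      assume neq: "x u \<noteq> x v"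
      have "jumps x l + jumps x [u, v] \<le> jumps x (l @ [u, v])" by (rule jumps_append_ge)
      moreover have "set (l @ [u, v]) \<subseteq> T \<inter> {a<..<b}" using l that(1,2) \<open>a < d\<close> by simp
      moreover have "\<forall>w\<in>set l. w < u" using that(1) d by fastforce
      then have "sorted_wrt (<) (l @ [u, v])" using l that(3) by (simp add: sorted_wrt_append) (meson less_trans)
      ultimately show False using max[of "l @ [u, v]"] neq by simp
    qed
    then show "x u = x v" if "u \<in> T \<inter> {d<..<b}" "v \<in> T \<inter> {d<..<b}" for u v
      using that by (metis linorder_neq_iff)
  qed
qed

text \<open>Bounded jump counts make \<open>x\<close> constant on \<open>T\<close> close to each
  time, separately on its right and on its left. The value of the path is the right limit along
  \<open>T\<close>; the assumption \<open>right\<close> makes this limit equal to \<open>x t\<close>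
  when \<open>t\<close> is in \<open>T\<close>.\<close>

lemma cadlag_extension:
  assumes T: "T \<subseteq> {0..}" and dense: "\<And>a b. 0 \<le> a \<Longrightarrow> a < b \<Longrightarrow> T \<inter> {a<..<b} \<noteq> {}"
    and x: "\<And>t. t \<in> T \<Longrightarrow> x t \<in> X"
    and right: "\<And>t. t \<in> T \<Longrightarrow> \<exists>h>0. \<forall>s \<in> T \<inter> {t..t + h}. x s = x t"
    and bdd: "\<And>n :: nat. \<exists>B. \<forall>l. set l \<subseteq> T \<inter> {0..real n} \<longrightarrow> sorted_wrt (<) l \<longrightarrow> jumps x l \<le> B"
  obtains \<omega> where "\<omega> \<in> cadlag_paths X" "\<And>t. t \<in> T \<Longrightarrow> \<omega> t = x t"
proof -
  have bdd': "\<exists>B. \<forall>l. set l \<subseteq> T \<inter> {a<..<b} \<longrightarrow> sorted_wrt (<) l \<longrightarrow> jumps x l \<le> B"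
    if "0 \<le> a" for a b
  proof -
    obtain n :: nat where "b \<le> real n" using real_arch_simple by blast
    then have "T \<inter> {a<..<b} \<subseteq> T \<inter> {0..real n}" using that by auto
    then show ?thesis using bdd[of n] by (meson subset_trans)
  qed
  have R: "\<exists>y\<in>X. \<exists>c>t. \<forall>s \<in> T \<inter> {t<..<c}. x s = y" if t: "t \<ge> 0" for t
  proof -
    obtain B where B: "\<And>l. set l \<subseteq> T \<inter> {t<..<t + 1} \<Longrightarrow> sorted_wrt (<) l \<Longrightarrow> jumps x l \<le> B"
      using bdd'[OF t] by blast
    obtain c where c: "t < c"
        "\<And>u v. u \<in> T \<inter> {t<..<c} \<Longrightarrow> v \<in> T \<inter> {t<..<c} \<Longrightarrow> x u = x v"
      using constant_near_endpoints[of t "t + 1" T x B] B by (metis less_add_one)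
    obtain u where u: "u \<in> T \<inter> {t<..<c}" using dense[OF t c(1)] by blast
    then have "x u \<in> X" "\<forall>s \<in> T \<inter> {t<..<c}. x s = x u" using c(2) x by blast+
    then show ?thesis using c(1) by blast
  qed
  have L: "\<exists>y\<in>X. \<exists>d<t. d \<ge> 0 \<and> (\<forall>s \<in> T \<inter> {d<..<t}. x s = y)" if t: "t > 0" for t
  proof -
    obtain B where B: "\<And>l. set l \<subseteq> T \<inter> {0<..<t} \<Longrightarrow> sorted_wrt (<) l \<Longrightarrow> jumps x l \<le> B"
      using bdd'[of 0 t] by blast
    obtain d where d: "0 < d" "d < t"
        "\<And>u v. u \<in> T \<inter> {d<..<t} \<Longrightarrow> v \<in> T \<inter> {d<..<t} \<Longrightarrow> x u = x v"
      using constant_near_endpoints[of 0 t T x B] B t by metis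
    obtain u where u: "u \<in> T \<inter> {d<..<t}" using dense[of d t] d by (meson less_imp_le ex_in_conv)
    then have "x u \<in> X" "\<forall>s \<in> T \<inter> {d<..<t}. x s = x u" using d(3) x by blast+
    then show ?thesis using d(1,2) less_imp_le by blast
  qed
  obtain y where y: "\<And>t. t \<ge> 0 \<Longrightarrow> y t \<in> X \<and> (\<exists>c>t. \<forall>s \<in> T \<inter> {t<..<c}. x s = y t)"
    using R by metis
  define \<omega> where "\<omega> = restrict y {0..}"
  have mem: "\<omega> t \<in> X" if "t \<ge> 0" for t using y that by (simp add: \<omega>_def)
  \<comment> \<open>Any right neighbourhood on which \<open>x\<close> is constant determines
    \<open>\<omega> t\<close>, because by density it shares a point of \<open>T\<close> with the
    neighbourhood that defines \<open>y t\<close>. Right-continuity, left limits and agreement with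
    \<open>x\<close> on \<open>T\<close> all follow from this.\<close>
  have \<omega>_eq: "\<omega> t = z" if t: "0 \<le> t" "t < b" "\<forall>s \<in> T \<inter> {t<..<b}. x s = z" for t b z
  proof -
    obtain c where c: "c > t" "\<forall>s \<in> T \<inter> {t<..<c}. x s = y t" using y[OF t(1)] by blast
    obtain s where s: "s \<in> T \<inter> {t<..<min b c}"
      using dense[of t "min b c"] t(1,2) c(1) by (metis ex_in_conv min_less_iff_conj)
    have "x s = y t" "x s = z" using s c(2) t(3) by (meson Int_iff greaterThanLessThan_iff min_less_iff_conj)+
    then have "y t = z" by simp
    then show ?thesis using t by (simp add: \<omega>_def)
  qed
  have "limitin (discrete_topology X) \<omega> (\<omega> t) (at_right t)" if t: "t \<ge> 0" for t
  proof -
    obtain c where c: "c > t" "\<forall>s \<in> T \<inter> {t<..<c}. x s = y t" using y[OF t] by blast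
    have "\<omega> s = \<omega> t" if "t < s" "s < c" for s
      using \<omega>_eq[of s c "y t"] that t c by (auto simp: \<omega>_def)
    then have "eventually (\<lambda>s. \<omega> s = \<omega> t) (at_right t)"
      using c(1) by (auto simp: eventually_at_right_field)
    then show ?thesis using mem[OF t] by (auto simp: limitin_def elim!: eventually_mono)
  qed
  moreover have "\<exists>l. limitin (discrete_topology X) \<omega> l (at_left t)" if t: "t > 0" for t
  proof -
    obtain z d where z: "z \<in> X" "d < t" "d \<ge> 0" "\<forall>s \<in> T \<inter> {d<..<t}. x s = z"
      using L[OF t] by blast
    have "\<omega> s = z" if "d < s" "s < t" for s
      using \<omega>_eq[of s t z] that z by auto
    then have "eventually (\<lambda>s. \<omega> s = z) (at_left t)"
      using z by (auto simp: eventually_at_left_field)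
    then have "limitin (discrete_topology X) \<omega> z (at_left t)"
      using z by (auto simp: limitin_def elim!: eventually_mono)
    then show ?thesis ..
  qed
  ultimately have "\<omega> \<in> cadlag_paths X"
    using mem by (auto simp: cadlag_paths_def \<omega>_def)
  moreover have "\<omega> t = x t" if "t \<in> T" for t
  proof -
    obtain h where h: "h > 0" "\<forall>s \<in> T \<inter> {t..t + h}. x s = x t" using right \<open>t \<in> T\<close> by blast
    have "\<forall>s \<in> T \<inter> {t<..<t + h}. x s = x t"
      using h(2) by (meson Int_iff atLeastAtMost_iff greaterThanLessThan_iff less_imp_le)
    moreover have "0 \<le> t" "t < t + h" using T that h(1) by auto
    ultimately show ?thesis by (rule \<omega>_eq[rotated 2])
  qed
  ultimately show thesis by (rule that)
qed

text \<open>Cantor's diagonal argument: from row \<open>n\<close> on, column \<open>n\<close> has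
  finitely many values, so by the pigeonhole principle every subsequence of rows has a further one
  along which this column is constant.\<close>

lemma eventually_constant_subsequence:
  fixes F :: "nat \<Rightarrow> nat \<Rightarrow> 'a"
  assumes K: "\<And>n. finite (K n)" and F: "\<And>m n. n \<le> m \<Longrightarrow> F m n \<in> K n"
  obtains r x where "strict_mono r" "\<And>n. eventually (\<lambda>m. F (r m) n = x n) sequentially"
proof -
  interpret subseqs "\<lambda>n s. \<exists>c. \<forall>m. F (s m) n = c"
  proof
    fix n and s :: "nat \<Rightarrow> nat" assume s: "strict_mono s"
    have "F (s m) n \<in> K n" if "n \<le> m" for m
      using F that seq_suble[OF s, of m] by simp
    then have "(\<lambda>m. F (s m) n) ` {n..} \<subseteq> K n" by auto
    then have "finite ((\<lambda>m. F (s m) n) ` {n..})" using K finite_subset by blast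
    then obtain m0 where inf: "infinite {m \<in> {n..}. F (s m) n = F (s m0) n}"
      using pigeonhole_infinite[of "{n..}" "\<lambda>m. F (s m) n"] infinite_Ici by auto
    obtain r :: "nat \<Rightarrow> nat" where r: "strict_mono r"
        "\<And>i. r i \<in> {m \<in> {n..}. F (s m) n = F (s m0) n}"
      using infinite_enumerate[OF inf] by blast
    then have "F ((s \<circ> r) m) n = F (s m0) n" for m by simp
    then show "\<exists>r' :: nat \<Rightarrow> nat. strict_mono r' \<and> (\<exists>c. \<forall>m. F ((s \<circ> r') m) n = c)" using r(1) by blast
  qed
  \<comment> \<open>From index \<open>Suc n\<close> on, the diagonal sequence is a subsequence of
    the one selected for column \<open>n\<close>, and constancy passes to subsequences.\<close>
  have "\<exists>c. \<forall>m. F ((diagseq \<circ> (+) (Suc n)) m) n = c" for n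
  proof (rule diagseq_holds)
    show "\<exists>c. \<forall>m. F ((s \<circ> r) m) n = c" if "\<exists>c. \<forall>m. F (s m) n = c"
      for r :: "nat \<Rightarrow> nat" and s n
      using that by (metis comp_apply)
  qed
  then obtain x where x: "\<forall>m. F ((diagseq \<circ> (+) (Suc n)) m) n = x n" for n
    using choice[of "\<lambda>n c. \<forall>m. F ((diagseq \<circ> (+) (Suc n)) m) n = c"] by auto
  have "eventually (\<lambda>m. F (diagseq m) n = x n) sequentially" for n
    unfolding eventually_sequentially
  proof (intro exI allI impI)
    fix m assume "Suc n \<le> m"
    then show "F (diagseq m) n = x n" using spec[OF x[of n], of "m - Suc n"] by simp
  qed
  then show thesis using that subseq_diagseq by blast
qed


section \<open>Upper expectations of finitary functions\<close>

text \<open>The required function of finitely many coordinates evaluates \<open>k\<close> at a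
  chosen path through each configuration. Step paths make the choice possible, and dependence on
  \<open>U\<close> alone makes it irrelevant.\<close>

lemma finitary_funsI:
  assumes U: "finite U" "U \<subseteq> {0..}"
    and k: "\<And>\<omega> \<omega>'. \<omega> \<in> cadlag_paths X \<Longrightarrow> \<omega>' \<in> cadlag_paths X \<Longrightarrow>
      (\<And>u. u \<in> U \<Longrightarrow> \<omega> u = \<omega>' u) \<Longrightarrow> k \<omega> = k \<omega>'"
    and B: "\<And>\<omega>. \<omega> \<in> cadlag_paths X \<Longrightarrow> \<bar>k \<omega>\<bar> \<le> B"
  shows "restrict k (cadlag_paths X) \<in> finitary_funs X"
proof -
  \<comment> \<open>Time \<open>0\<close> is added because \<open>U\<close> may be empty while
    members of \<open>time_sets\<close> are not.\<close>
  define V where "V = insert 0 U"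
  have V: "V \<in> time_sets" using U by (auto simp: V_def time_sets_def)
  define p where "p x = (SOME \<omega>. \<omega> \<in> cadlag_paths X \<and> restrict \<omega> V = x)" for x
  have p: "p x \<in> cadlag_paths X \<and> restrict (p x) V = x" if "x \<in> V \<rightarrow>\<^sub>E X" for x
  proof -
    obtain \<omega> where "\<omega> \<in> cadlag_paths X" "restrict \<omega> V = x" by (rule step_path_exists[OF V \<open>x \<in> V \<rightarrow>\<^sub>E X\<close>])
    then show ?thesis unfolding p_def by (metis (mono_tags, lifting) someI)
  qed
  define f where "f = (\<lambda>x\<in>V \<rightarrow>\<^sub>E X. k (p x))"
  have "\<bar>f x\<bar> \<le> B" if "x \<in> V \<rightarrow>\<^sub>E X" for x
    using p[OF that] B that by (auto simp: f_def)
  then have "f \<in> bounded_funs (V \<rightarrow>\<^sub>E X)"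
    by (auto simp: bounded_funs_def bounded_iff f_def)
  moreover have "restrict k (cadlag_paths X) = compose (cadlag_paths X) f (\<lambda>\<omega>. restrict \<omega> V)"
  proof
    fix \<omega>
    show "restrict k (cadlag_paths X) \<omega> = compose (cadlag_paths X) f (\<lambda>\<omega>. restrict \<omega> V) \<omega>"
    proof (cases "\<omega> \<in> cadlag_paths X")
      case True
      note r = restrict_path_in[OF True V]
      have "k \<omega> = k (p (restrict \<omega> V))"
      proof (rule k[OF True])
        fix u assume "u \<in> U"
        then have "u \<in> V" by (simp add: V_def)
        then show "\<omega> u = p (restrict \<omega> V) u" using p[OF r] by (metis restrict_apply')
      qed (use p[OF r] in simp)
      then show ?thesis using True r by (simp add: compose_def f_def)
    qed (simp add: compose_def)
  qed
  ultimately show ?thesis using V by (auto simp: finitary_funs_def)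
qed

locale upper_process =
  fixes X :: "'x set" and E :: "((real \<Rightarrow> 'x) \<Rightarrow> real) \<Rightarrow> real"
  assumes ue: "upper_expectation (cadlag_paths X) (finitary_funs X) E"
begin

abbreviation paths :: "(real \<Rightarrow> 'x) set" where
  "paths \<equiv> cadlag_paths X"

text \<open>Both this and \<open>UE\<close> restrict to \<open>paths\<close> first, so that sums and
  multiples can be written as plain lambda terms instead of extensional functions.\<close>

definition finitary :: "((real \<Rightarrow> 'x) \<Rightarrow> real) \<Rightarrow> bool" where
  "finitary k \<longleftrightarrow> restrict k paths \<in> finitary_funs X"

definition UE :: "((real \<Rightarrow> 'x) \<Rightarrow> real) \<Rightarrow> real" where
  "UE k = E (restrict k paths)"

lemma finitaryE:
  assumes "finitary k"
  obtains U B where "finite U" "U \<subseteq> {0..}"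
    "\<And>\<omega> \<omega>'. \<omega> \<in> paths \<Longrightarrow> \<omega>' \<in> paths \<Longrightarrow> \<forall>u\<in>U. \<omega> u = \<omega>' u \<Longrightarrow> k \<omega> = k \<omega>'"
    "\<And>\<omega>. \<omega> \<in> paths \<Longrightarrow> \<bar>k \<omega>\<bar> \<le> B"
proof -
  obtain U f where U: "U \<in> time_sets" and f: "f \<in> bounded_funs (U \<rightarrow>\<^sub>E X)"
    and k: "restrict k paths = compose paths f (\<lambda>\<omega>. restrict \<omega> U)"
    using assms by (auto simp: finitary_def finitary_funs_def)
  have k_eq: "k \<omega> = f (restrict \<omega> U)" if "\<omega> \<in> paths" for \<omega>
    using fun_cong[OF k, of \<omega>] that by (simp add: compose_def)
  obtain B where B: "\<bar>f x\<bar> \<le> B" if "x \<in> U \<rightarrow>\<^sub>E X" for x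
    using f by (auto simp: bounded_funs_def bounded_iff)
  show thesis
  proof
    show "finite U" "U \<subseteq> {0..}" using U by (auto simp: time_sets_def)
    show "\<bar>k \<omega>\<bar> \<le> B" if "\<omega> \<in> paths" for \<omega>
      using B[OF restrict_path_in[OF that U]] that by (simp add: k_eq)
    show "k \<omega> = k \<omega>'" if "\<omega> \<in> paths" "\<omega>' \<in> paths" and "\<forall>u\<in>U. \<omega> u = \<omega>' u" for \<omega> \<omega>'
    proof -
      have "restrict \<omega> U = restrict \<omega>' U" using that(3) by (auto simp: fun_eq_iff)
      then show ?thesis using that by (simp add: k_eq)
    qed
  qed
qed

lemma
  shows finitary_const: "finitary (\<lambda>_. c)"
    and finitary_add: "finitary k \<Longrightarrow> finitary k' \<Longrightarrow> finitary (\<lambda>\<omega>. k \<omega> + k' \<omega>)"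
    and finitary_scale: "finitary k \<Longrightarrow> finitary (\<lambda>\<omega>. c * k \<omega>)"
proof -
  note lin = linear_space_finitary_funs[of X, unfolded linear_space_with_constants_def]
  show "finitary (\<lambda>_. c)" unfolding finitary_def using lin by blast
  show "finitary (\<lambda>\<omega>. k \<omega> + k' \<omega>)" if "finitary k" "finitary k'"
  proof -
    have "(\<lambda>\<omega>\<in>paths. restrict k paths \<omega> + restrict k' paths \<omega>) \<in> finitary_funs X"
      using lin that unfolding finitary_def by blast
    then show ?thesis by (simp add: finitary_def cong: restrict_cong)
  qed
  show "finitary (\<lambda>\<omega>. c * k \<omega>)" if "finitary k"
  proof -
    have "(\<lambda>\<omega>\<in>paths. c * restrict k paths \<omega>) \<in> finitary_funs X"
      using lin that unfolding finitary_def by blast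
    then show ?thesis by (simp add: finitary_def cong: restrict_cong)
  qed
qed

lemma UE_mono: "finitary k \<Longrightarrow> finitary k' \<Longrightarrow> (\<And>\<omega>. \<omega> \<in> paths \<Longrightarrow> k \<omega> \<le> k' \<omega>) \<Longrightarrow> UE k \<le> UE k'"
  using ue by (simp add: upper_expectation_def finitary_def UE_def)

lemma UE_const: "UE (\<lambda>_. c) = c"
  using ue unfolding upper_expectation_def UE_def by blast

lemma UE_add: "finitary k \<Longrightarrow> finitary k' \<Longrightarrow> UE (\<lambda>\<omega>. k \<omega> + k' \<omega>) \<le> UE k + UE k'"
proof -
  assume k: "finitary k" "finitary k'"
  have "E (\<lambda>\<omega>\<in>paths. restrict k paths \<omega> + restrict k' paths \<omega>) \<le> UE k + UE k'"
    using ue k unfolding upper_expectation_def finitary_def UE_def by blast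
  then show ?thesis by (simp add: UE_def cong: restrict_cong)
qed

lemma UE_scale: "finitary k \<Longrightarrow> 0 \<le> c \<Longrightarrow> UE (\<lambda>\<omega>. c * k \<omega>) = c * UE k"
proof -
  assume k: "finitary k" "0 \<le> c"
  have "E (\<lambda>\<omega>\<in>paths. c * restrict k paths \<omega>) = c * UE k"
    using ue k unfolding upper_expectation_def finitary_def UE_def by blast
  then show ?thesis by (simp add: UE_def cong: restrict_cong)
qed

lemma finitary_sum: "(\<And>i. i \<in> I \<Longrightarrow> finitary (k i)) \<Longrightarrow> finitary (\<lambda>\<omega>. \<Sum>i\<in>I. k i \<omega>)"
proof (induction I rule: infinite_finite_induct)
  case (insert i I)
  then show ?case using finitary_add[of "k i" "\<lambda>\<omega>. \<Sum>i\<in>I. k i \<omega>"] by simp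
qed (simp_all add: finitary_const)

lemma UE_sum: "(\<And>i. i \<in> I \<Longrightarrow> finitary (k i)) \<Longrightarrow> UE (\<lambda>\<omega>. \<Sum>i\<in>I. k i \<omega>) \<le> (\<Sum>i\<in>I. UE (k i))"
proof (induction I rule: infinite_finite_induct)
  case (insert i I)
  then have "UE (\<lambda>\<omega>. k i \<omega> + (\<Sum>i\<in>I. k i \<omega>)) \<le> UE (k i) + UE (\<lambda>\<omega>. \<Sum>i\<in>I. k i \<omega>)"
    by (intro UE_add finitary_sum) auto
  moreover have "UE (\<lambda>\<omega>. \<Sum>i\<in>I. k i \<omega>) \<le> (\<Sum>i\<in>I. UE (k i))" by (rule insert.IH) (use insert.prems in auto)
  ultimately show ?case using insert.hyps by simp
qed (simp_all add: UE_const)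

lemma finitary_of_bool:
  assumes "finite U" "U \<subseteq> {0..}"
    and "\<And>\<omega> \<omega>'. (\<And>u. u \<in> U \<Longrightarrow> \<omega> u = \<omega>' u) \<Longrightarrow> P \<omega> = P \<omega>'"
  shows "finitary (\<lambda>\<omega>. of_bool (P \<omega>))"
  unfolding finitary_def
proof (rule finitary_funsI[of U _ _ 1])
  fix \<omega> \<omega>' :: "real \<Rightarrow> 'x" assume "\<And>u. u \<in> U \<Longrightarrow> \<omega> u = \<omega>' u"
  then have "P \<omega> = P \<omega>'" by (rule assms(3))
  then show "of_bool (P \<omega>) = (of_bool (P \<omega>') :: real)" by simp
qed (use assms(1,2) in simp_all)

lemma finitary_neq: "0 \<le> s \<Longrightarrow> 0 \<le> t \<Longrightarrow> finitary (\<lambda>\<omega>. of_bool (\<omega> s \<noteq> \<omega> t))"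
  by (rule finitary_of_bool[of "{s, t}"]) simp_all

lemma finitary_notin: "0 \<le> t \<Longrightarrow> finitary (\<lambda>\<omega>. of_bool (\<omega> t \<notin> K))"
  by (rule finitary_of_bool[of "{t}"]) simp_all

lemma finitary_jumps: "set l \<subseteq> {0..} \<Longrightarrow> finitary (\<lambda>\<omega>. real (jumps \<omega> l))"
  unfolding finitary_def
proof (rule finitary_funsI[of "set l" _ _ "real (length l)"])
  fix \<omega> \<omega>' :: "real \<Rightarrow> 'x" assume "\<And>u. u \<in> set l \<Longrightarrow> \<omega> u = \<omega>' u"
  then show "real (jumps \<omega> l) = real (jumps \<omega>' l)" by (metis jumps_cong)
qed (simp_all add: jumps_le_length)

text \<open>By subadditivity a step from \<open>u\<close> to \<open>v\<close> costs at most
  \<open>L * (v - u)\<close>, and these lengths telescope. The bound is therefore independent of the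
  number of times in the list.\<close>

lemma UE_jumps_le:
  assumes a: "0 \<le> a" and "set l \<subseteq> {a..b}" "sorted_wrt (<) l" "0 \<le> L" "a \<le> b"
    and L: "\<And>s t. a \<le> s \<Longrightarrow> s \<le> t \<Longrightarrow> t \<le> b \<Longrightarrow> UE (\<lambda>\<omega>. of_bool (\<omega> s \<noteq> \<omega> t)) \<le> L * (t - s)"
  shows "UE (\<lambda>\<omega>. real (jumps \<omega> l)) \<le> L * (b - a)"
proof -
  have *: "UE (\<lambda>\<omega>. real (jumps \<omega> (u # l))) \<le> L * (b - u)"
    if "set (u # l) \<subseteq> {a..b}" "sorted_wrt (<) (u # l)" for u l
    using that
  proof (induction l arbitrary: u)
    case Nil
    then show ?case using \<open>0 \<le> L\<close> by (simp add: UE_const)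
  next
    case (Cons v l)
    have sub: "set (u # v # l) \<subseteq> {0..}"
    proof
      fix t assume "t \<in> set (u # v # l)"
      then have "t \<in> {a..b}" using Cons.prems(1) by blast
      then show "t \<in> {0..}" using a by simp
    qed
    have "UE (\<lambda>\<omega>. real (jumps \<omega> (u # v # l)))
        = UE (\<lambda>\<omega>. of_bool (\<omega> u \<noteq> \<omega> v) + real (jumps \<omega> (v # l)))"
      by simp
    also have "\<dots> \<le> UE (\<lambda>\<omega>. of_bool (\<omega> u \<noteq> \<omega> v)) + UE (\<lambda>\<omega>. real (jumps \<omega> (v # l)))"
      using sub by (intro UE_add finitary_neq finitary_jumps) auto
    also have "\<dots> \<le> L * (v - u) + L * (b - v)"
      using Cons by (intro add_mono L Cons.IH) auto
    finally show ?case by (simp add: algebra_simps)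
  qed
  show ?thesis
  proof (cases l)
    case Nil
    then show ?thesis using assms by (simp add: UE_const)
  next
    case (Cons u k)
    have "UE (\<lambda>\<omega>. real (jumps \<omega> l)) \<le> L * (b - u)" using *[of u k] assms Cons by blast
    also have "\<dots> \<le> L * (b - a)" using assms Cons by (auto intro!: mult_left_mono)
    finally show ?thesis .
  qed
qed

lemma UE_neq_triangle:
  assumes "0 \<le> s" "0 \<le> t" "0 \<le> u"
  shows "UE (\<lambda>\<omega>. of_bool (\<omega> s \<noteq> \<omega> u))
    \<le> UE (\<lambda>\<omega>. of_bool (\<omega> s \<noteq> \<omega> t)) + UE (\<lambda>\<omega>. of_bool (\<omega> t \<noteq> \<omega> u))"
proof -
  have "UE (\<lambda>\<omega>. of_bool (\<omega> s \<noteq> \<omega> u)) \<le> UE (\<lambda>\<omega>. of_bool (\<omega> s \<noteq> \<omega> t) + of_bool (\<omega> t \<noteq> \<omega> u))"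
    using assms by (intro UE_mono finitary_add finitary_neq) auto
  also have "\<dots> \<le> UE (\<lambda>\<omega>. of_bool (\<omega> s \<noteq> \<omega> t)) + UE (\<lambda>\<omega>. of_bool (\<omega> t \<noteq> \<omega> u))"
    using assms by (intro UE_add finitary_neq)
  finally show ?thesis .
qed

lemma UE_neq_commute: "UE (\<lambda>\<omega>. of_bool (\<omega> s \<noteq> \<omega> t)) = UE (\<lambda>\<omega>. of_bool (\<omega> t \<noteq> \<omega> s))"
  by (rule arg_cong[of _ _ UE]) auto

text \<open>The limit superior controls the distance to \<open>t\<close> only within a radius
  depending on \<open>t\<close>; the added \<open>1\<close> is the slack that turns
  \<open>\<le> c\<close> in the limit into a bound near \<open>t\<close>. The triangle inequality
  glues the local bounds, with the bisection principle \<open>Bolzano\<close> in place of a finite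
  subcover.\<close>

lemma UE_neq_le:
  assumes lim: "\<And>t. t \<in> {0..b} \<Longrightarrow>
      Limsup (at t within {0..}) (\<lambda>s. ereal (UE (\<lambda>\<omega>. of_bool (\<omega> s \<noteq> \<omega> t)) / \<bar>s - t\<bar>)) \<le> ereal c"
    and st: "0 \<le> s" "s \<le> t" "t \<le> b"
  shows "UE (\<lambda>\<omega>. of_bool (\<omega> s \<noteq> \<omega> t)) \<le> (c + 1) * (t - s)"
proof -
  let ?\<rho> = "\<lambda>s t. UE (\<lambda>\<omega>. of_bool (\<omega> s \<noteq> \<omega> t))"
  have near: "\<exists>d>0. \<forall>s\<ge>0. \<bar>s - t\<bar> < d \<longrightarrow> ?\<rho> s t \<le> (c + 1) * \<bar>s - t\<bar>" if t: "t \<in> {0..b}" for t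
  proof -
    have "ereal c < ereal (c + 1)" by simp
    then have "eventually (\<lambda>s. ereal (?\<rho> s t / \<bar>s - t\<bar>) < ereal (c + 1)) (at t within {0..})"
      using lim[OF t] by (intro Limsup_lessD) (rule le_less_trans)
    then obtain d where d: "d > 0"
      "\<And>s. s \<in> {0..} \<Longrightarrow> s \<noteq> t \<Longrightarrow> dist s t < d \<Longrightarrow> ?\<rho> s t / \<bar>s - t\<bar> < c + 1"
      by (auto simp: eventually_at)
    have "?\<rho> s t \<le> (c + 1) * \<bar>s - t\<bar>" if "s \<ge> 0" "\<bar>s - t\<bar> < d" for s
    proof (cases "s = t")
      case False
      then have "?\<rho> s t / \<bar>s - t\<bar> < c + 1" using d(2)[of s] that by (simp add: dist_real_def)
      then show ?thesis using False by (simp add: divide_less_eq)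
    qed (simp add: UE_const)
    then show ?thesis using d(1) by blast
  qed
  \<comment> \<open>Bisection needs the local estimate on all short intervals around
    \<open>x\<close>, also those sticking out of the interval from \<open>s\<close> to
    \<open>t\<close>; hence the guard is only \<open>0 \<le> u\<close>.\<close>
  define P where "P u v \<longleftrightarrow> 0 \<le> u \<longrightarrow> ?\<rho> u v \<le> (c + 1) * (v - u)" for u v
  have "P s t" using st(2)
  proof (induction rule: Bolzano)
    case (trans u v w)
    show ?case unfolding P_def
    proof
      assume u: "0 \<le> u"
      have "?\<rho> u w \<le> ?\<rho> u v + ?\<rho> v w" by (rule UE_neq_triangle) (use u trans in auto)
      also have "\<dots> \<le> (c + 1) * (v - u) + (c + 1) * (w - v)"
        using trans u unfolding P_def by auto
      finally show "?\<rho> u w \<le> (c + 1) * (w - u)" by (simp add: algebra_simps)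
    qed
  next
    case (local x)
    then have x: "x \<in> {0..b}" using st by auto
    then obtain d where d: "d > 0" "\<And>s. s \<ge> 0 \<Longrightarrow> \<bar>s - x\<bar> < d \<Longrightarrow> ?\<rho> s x \<le> (c + 1) * \<bar>s - x\<bar>"
      using near[OF x] by blast
    have "P u v" if "u \<le> x \<and> x \<le> v \<and> v - u < d" for u v
      unfolding P_def
    proof
      assume u: "0 \<le> u"
      \<comment> \<open>The local bound concerns pairs containing \<open>x\<close>, so the interval
        is split there.\<close>
      have "?\<rho> u v \<le> ?\<rho> u x + ?\<rho> x v" by (rule UE_neq_triangle) (use u that in auto)
      also have "\<dots> \<le> (c + 1) * (x - u) + (c + 1) * (v - x)"
      proof (rule add_mono)
        show "?\<rho> u x \<le> (c + 1) * (x - u)"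
          using d(2)[of u] u that by (simp add: abs_of_nonpos)
        show "?\<rho> x v \<le> (c + 1) * (v - x)"
          using d(2)[of v] u that by (simp add: UE_neq_commute[of x v])
      qed
      finally show "?\<rho> u v \<le> (c + 1) * (v - u)" by (simp add: algebra_simps)
    qed
    then show ?case using d(1) by blast
  qed
  then show ?thesis using st by (simp add: P_def)
qed

end


section \<open>Downward continuity\<close>

text \<open>These two properties are all that the limiting argument uses: \<open>lipschitz\<close>
  stands for the rate bound, \<open>tight\<close> for countability together with downward continuity
  at single times.\<close>

locale tight_lipschitz_process = upper_process X E
  for X :: "'x set" and E :: "((real \<Rightarrow> 'x) \<Rightarrow> real) \<Rightarrow> real" +
  assumes lipschitz: "\<exists>L\<ge>0. \<forall>s t. 0 \<le> s \<longrightarrow> s \<le> t \<longrightarrow> t \<le> real n \<longrightarrow>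
      UE (\<lambda>\<omega>. of_bool (\<omega> s \<noteq> \<omega> t)) \<le> L * (t - s)"
    and tight: "0 \<le> t \<Longrightarrow> 0 < \<eta> \<Longrightarrow> \<exists>K. finite K \<and> UE (\<lambda>\<omega>. of_bool (\<omega> t \<notin> K)) \<le> \<eta>"
begin

lemma UE_jumps_bounded:
  "\<exists>B>0. \<forall>W. finite W \<longrightarrow> UE (\<lambda>\<omega>. real (jumps \<omega> (sorted_list_of_set (W \<inter> {0..real n})))) \<le> B"
proof -
  obtain L where L: "L \<ge> 0" "\<And>s t. 0 \<le> s \<Longrightarrow> s \<le> t \<Longrightarrow> t \<le> real n \<Longrightarrow>
      UE (\<lambda>\<omega>. of_bool (\<omega> s \<noteq> \<omega> t)) \<le> L * (t - s)"
    using lipschitz by blast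
  have "UE (\<lambda>\<omega>. real (jumps \<omega> (sorted_list_of_set (W \<inter> {0..real n})))) \<le> L * (real n - 0)"
    if "finite W" for W
    using that L by (intro UE_jumps_le) auto
  \<comment> \<open>The added \<open>1\<close> makes the bound positive, since it later becomes the
    denominator \<open>c k\<close> of a penalty.\<close>
  moreover have "L * (real n - 0) \<le> L * real n + 1" "L * real n + 1 > 0"
    using L(1) by (auto intro: add_nonneg_pos)
  ultimately show ?thesis by (meson order_trans)
qed

lemma UE_jumps_right_small:
  assumes t: "0 \<le> t" and \<eta>: "0 < \<eta>"
  shows "\<exists>h>0. \<forall>W. finite W \<longrightarrow> UE (\<lambda>\<omega>. real (jumps \<omega> (sorted_list_of_set (W \<inter> {t..t + h})))) \<le> \<eta>"
proof -
  obtain n :: nat where n: "t + 1 \<le> real n" using real_arch_simple by blast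
  obtain L where L: "L \<ge> 0" "\<And>s t. 0 \<le> s \<Longrightarrow> s \<le> t \<Longrightarrow> t \<le> real n \<Longrightarrow>
      UE (\<lambda>\<omega>. of_bool (\<omega> s \<noteq> \<omega> t)) \<le> L * (t - s)"
    using lipschitz[of n] by blast
  \<comment> \<open>The \<open>L + 1\<close> avoids division by zero, and the cap at
    \<open>1\<close> keeps \<open>t + h\<close> below \<open>real n\<close>, where \<open>L\<close>
    is valid.\<close>
  define h where "h = min 1 (\<eta> / (L + 1))"
  have h: "h > 0" "h \<le> 1" "h \<le> \<eta> / (L + 1)" using \<eta> L(1) by (auto simp: h_def)
  have "L * h \<le> (L + 1) * (\<eta> / (L + 1))" using h L(1) by (intro mult_mono) auto
  also have "\<dots> = \<eta>" using L(1) by simp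
  finally have *: "L * ((t + h) - t) \<le> \<eta>" by simp
  have "UE (\<lambda>\<omega>. real (jumps \<omega> (sorted_list_of_set (W \<inter> {t..t + h})))) \<le> L * ((t + h) - t)"
    if "finite W" for W
    using that L h t n by (intro UE_jumps_le) auto
  then show ?thesis using h(1) * by (meson order_trans)
qed

text \<open>Otherwise \<open>g\<close> would lie below the sum of the penalties on all paths, and
  isotonicity with subadditivity would bound \<open>UE g\<close> by the sum of their upper
  expectations.\<close>

lemma ex_path_above_penalties:
  assumes g: "finitary g" and p: "\<And>i. i \<in> I \<Longrightarrow> finitary (p i)" and less: "(\<Sum>i\<in>I. UE (p i)) < UE g"
  shows "\<exists>\<omega>\<in>paths. (\<Sum>i\<in>I. p i \<omega>) < g \<omega>"
proof (rule ccontr)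
  assume "\<not> ?thesis"
  then have "UE g \<le> UE (\<lambda>\<omega>. \<Sum>i\<in>I. p i \<omega>)"
    by (intro UE_mono g finitary_sum p) (auto simp: not_less)
  also have "\<dots> \<le> (\<Sum>i\<in>I. UE (p i))" by (intro UE_sum p)
  finally show False using less by simp
qed

text \<open>An argument in the manner of Dini's theorem, in which the penalties confine the paths
  enough to replace compactness.\<close>

lemma UE_decreasing_to_zero:
  assumes g: "\<And>n. finitary (g n)"
    and dec: "\<And>\<omega>. \<omega> \<in> paths \<Longrightarrow> decseq (\<lambda>n. g n \<omega>)"
    and lim: "\<And>\<omega>. \<omega> \<in> paths \<Longrightarrow> (\<lambda>n. g n \<omega>) \<longlonglongrightarrow> 0"
    and \<epsilon>: "\<epsilon> > 0"
  shows "\<exists>n. UE (g n) < \<epsilon>"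
proof (rule ccontr)
  assume "\<not> ?thesis"
  then have ge: "UE (g n) \<ge> \<epsilon>" for n by (simp add: not_less)

  \<comment> \<open>A uniform bound and a countable dense set of times\<close>
  have "\<exists>U. finite U \<and> U \<subseteq> {0..} \<and>
      (\<forall>\<omega>\<in>paths. \<forall>\<omega>'\<in>paths. (\<forall>u\<in>U. \<omega> u = \<omega>' u) \<longrightarrow> g n \<omega> = g n \<omega>')" for n
    by (rule finitaryE[OF g[of n]]) blast
  then obtain U where U: "\<And>n. finite (U n)" "\<And>n. U n \<subseteq> {0..}"
    and g_eq: "\<And>n \<omega> \<omega>'. \<omega> \<in> paths \<Longrightarrow> \<omega>' \<in> paths \<Longrightarrow> \<forall>u\<in>U n. \<omega> u = \<omega>' u \<Longrightarrow> g n \<omega> = g n \<omega>'"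
    by metis
  obtain B where B: "\<bar>g 0 \<omega>\<bar> \<le> B" if "\<omega> \<in> paths" for \<omega>
    by (rule finitaryE[OF g[of 0]]) blast
  \<comment> \<open>As the sequence decreases from \<open>g 0\<close>, this one positive constant
    lies strictly above every \<open>g n\<close>.\<close>
  define C where "C = max B 0 + 1"
  have C: "C > 0" by (simp add: C_def)
  have g_less: "g n \<omega> < C" if "\<omega> \<in> paths" for n \<omega>
    using decseqD[OF dec[OF that], of 0 n] B[OF that] by (simp add: C_def abs_le_iff)

  \<comment> \<open>The sets \<open>U n\<close> are included so that convergence on \<open>T\<close>
    determines each \<open>g n\<close>; the rationals make \<open>T\<close> dense.\<close>
  define T where "T = (\<Union>n. U n) \<union> (\<rat> \<inter> {0..})"
  have T: "countable T" "T \<noteq> {}" "T \<subseteq> {0..}"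
    using U by (auto simp: T_def countable_rat uncountable_infinite intro: countable_finite intro!: countable_Int1)
  have T_dense: "T \<inter> {a<..<b} \<noteq> {}" if ab: "0 \<le> a" "a < b" for a b
  proof -
    obtain q where "q \<in> \<rat>" "a < q" "q < b" using Rats_dense_in_real[OF ab(2)] by blast
    then have "q \<in> T \<inter> {a<..<b}" using ab(1) by (simp add: T_def)
    then show ?thesis by blast
  qed
  define t where "t = from_nat_into T"
  have t: "range t = T" using T by (simp add: t_def)
  have t0: "0 \<le> t k" for k using t T(3) by (metis atLeast_iff rangeI subsetD)

  \<comment> \<open>Penalties with small upper expectation\<close>
  define e where "e k = \<epsilon> / 4 * (1 / 2) ^ (k + 2)" for k :: nat
  have e: "e k > 0" for k using \<epsilon> by (simp add: e_def)
  \<comment> \<open>Three penalties of size at most \<open>e k\<close> for each \<open>k\<close>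
    total less than \<open>3 * \<epsilon> / 4\<close>, which leaves \<open>\<epsilon> / 4\<close> as
    a margin for \<open>g n\<close>.\<close>
  have e_sum: "(\<Sum>k\<le>n. e k) < \<epsilon> / 4" for n
  proof -
    have "(\<Sum>k\<le>n. e k) = \<epsilon> / 4 * ((1 / 4) * (\<Sum>k\<le>n. (1 / 2) ^ k))"
      by (simp add: e_def sum_distrib_left power_add mult.commute mult.left_commute)
    also have "(\<Sum>k\<le>n. (1 / 2 :: real) ^ k) = 2 - (1 / 2) ^ n"
      by (induction n) auto
    also have "\<epsilon> / 4 * ((1 / 4) * (2 - (1 / 2) ^ n)) < \<epsilon> / 4 * 1"
      using \<epsilon> by (intro mult_strict_left_mono) (auto simp: field_simps intro: add_pos_pos)
    finally show ?thesis by simp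
  qed

  \<comment> \<open>Counting along the first \<open>Suc n\<close> enumerated times keeps
    \<open>J\<close> finitary, while the bounds on its upper expectation below are uniform in
    \<open>n\<close>.\<close>
  define J where "J n a b \<omega> = real (jumps \<omega> (sorted_list_of_set (t ` {..n} \<inter> {a..b})))"
    for n a b and \<omega> :: "real \<Rightarrow> 'x"
  have J: "finitary (J n a b)" for n a b
    unfolding J_def using t0 by (intro finitary_jumps) auto
  have J0: "J n a b \<omega> \<ge> 0" for n a b \<omega> by (simp add: J_def)

  \<comment> \<open>The bound is \<open>e k / C\<close> since the penalty multiplies this indicator
    by \<open>C\<close>; the same holds for the jumps just after \<open>t k\<close>.\<close>
  have "\<exists>K. finite K \<and> UE (\<lambda>\<omega>. of_bool (\<omega> (t k) \<notin> K)) \<le> e k / C" for k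
    using C e by (intro tight t0) simp
  then obtain K where K: "\<And>k. finite (K k)" "\<And>k. UE (\<lambda>\<omega>. of_bool (\<omega> (t k) \<notin> K k)) \<le> e k / C"
    by metis
  have "\<exists>h>0. \<forall>n. UE (J n (t k) (t k + h)) \<le> e k / C" for k
    using UE_jumps_right_small[OF t0, of "e k / C"] C e[of k] unfolding J_def
    by (metis divide_pos_pos finite_atMost finite_imageI)
  then obtain h where h: "\<And>k. h k > 0" "\<And>k n. UE (J n (t k) (t k + h k)) \<le> e k / C"
    by metis
  have "\<exists>c>0. \<forall>n. UE (J n 0 (real k)) \<le> c" for k
    using UE_jumps_bounded[of k] unfolding J_def by (metis finite_atMost finite_imageI)
  then obtain c where c: "\<And>k. c k > 0" "\<And>k n. UE (J n 0 (real k)) \<le> c k"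
    by metis

  txt \<open>Since \<open>g n < C\<close>, a path at which \<open>g n\<close> exceeds the penalties has each of the three summands
    below \<open>C\<close>; for the first two this means that they vanish.\<close>
  define p where "p n k \<omega> = C * of_bool (\<omega> (t k) \<notin> K k) + C * J n (t k) (t k + h k) \<omega>
      + e k / c k * J n 0 (real k) \<omega>" for n k \<omega>
  have p_fin: "finitary (p n k)" for n k
    unfolding p_def by (intro finitary_add finitary_scale finitary_notin J t0)
  have p_UE: "UE (p n k) \<le> 3 * e k" for n k
  proof -
    have "UE (p n k) \<le> UE (\<lambda>\<omega>. C * of_bool (\<omega> (t k) \<notin> K k) + C * J n (t k) (t k + h k) \<omega>)
        + UE (\<lambda>\<omega>. e k / c k * J n 0 (real k) \<omega>)"
      unfolding p_def by (intro UE_add finitary_add finitary_scale finitary_notin J t0)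
    also have "\<dots> \<le> (UE (\<lambda>\<omega>. C * of_bool (\<omega> (t k) \<notin> K k)) + UE (\<lambda>\<omega>. C * J n (t k) (t k + h k) \<omega>))
        + UE (\<lambda>\<omega>. e k / c k * J n 0 (real k) \<omega>)"
      by (intro add_right_mono UE_add finitary_scale finitary_notin J t0)
    also have "\<dots> = C * UE (\<lambda>\<omega>. of_bool (\<omega> (t k) \<notin> K k)) + C * UE (J n (t k) (t k + h k))
        + e k / c k * UE (J n 0 (real k))"
      using C e[of k] c(1)[of k] t0 J
      by (simp only: UE_scale finitary_notin less_imp_le divide_pos_pos)
    also have "\<dots> \<le> C * (e k / C) + C * (e k / C) + e k / c k * c k"
      using C e[of k] c(1)[of k] K(2) h(2) c(2) by (intro add_mono mult_left_mono) auto
    also have "\<dots> = 3 * e k" using C c(1)[of k] by simp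
    finally show ?thesis .
  qed

  \<comment> \<open>Paths at which the functions exceed the penalties\<close>
  have "\<exists>\<omega>\<in>paths. \<epsilon> / 4 + (\<Sum>k\<le>n. p n k \<omega>) < g n \<omega>" for n
  proof -
    \<comment> \<open>The index \<open>None\<close> carries the constant margin
      \<open>\<epsilon> / 4\<close> as one more penalty.\<close>
    let ?p = "\<lambda>i. case i of None \<Rightarrow> (\<lambda>_. \<epsilon> / 4) | Some k \<Rightarrow> p n k"
    have split: "(\<Sum>i\<in>insert None (Some ` {..n}). f i) = f None + (\<Sum>k\<le>n. f (Some k))"
      for f :: "nat option \<Rightarrow> real"
      by (subst sum.insert) (auto simp: sum.reindex)
    have "\<exists>\<omega>\<in>paths. (\<Sum>i\<in>insert None (Some ` {..n}). ?p i \<omega>) < g n \<omega>"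
    proof (rule ex_path_above_penalties[OF g])
      show "finitary (?p i)" for i by (cases i) (simp_all add: finitary_const p_fin)
      have "(\<Sum>i\<in>insert None (Some ` {..n}). UE (?p i)) = \<epsilon> / 4 + (\<Sum>k\<le>n. UE (p n k))"
        by (subst split) (simp add: UE_const)
      also have "\<dots> \<le> \<epsilon> / 4 + (\<Sum>k\<le>n. 3 * e k)" by (intro add_left_mono sum_mono p_UE)
      also have "\<dots> = \<epsilon> / 4 + 3 * (\<Sum>k\<le>n. e k)" by (simp add: sum_distrib_left)
      also have "\<dots> < \<epsilon>" using e_sum[of n] by simp
      also have "\<epsilon> \<le> UE (g n)" by (rule ge)
      finally show "(\<Sum>i\<in>insert None (Some ` {..n}). UE (?p i)) < UE (g n)" .
    qed
    then show ?thesis by (subst (asm) split) simp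
  qed
  then obtain \<omega> where \<omega>: "\<And>n. \<omega> n \<in> paths" and \<omega>_g: "\<And>n. \<epsilon> / 4 + (\<Sum>k\<le>n. p n k (\<omega> n)) < g n (\<omega> n)"
    by metis
  have p0: "p n k x \<ge> 0" for n k x
    unfolding p_def using C e[of k] c(1)[of k] J0 by (intro add_nonneg_nonneg mult_nonneg_nonneg) auto
  have g_\<omega>: "\<epsilon> / 4 < g n (\<omega> n)" for n
    using \<omega>_g[of n] sum_nonneg[of "{..n}" "\<lambda>k. p n k (\<omega> n)"] p0 by simp
  have p_less: "p n k (\<omega> n) < C" if "k \<le> n" for n k
    using member_le_sum[of k "{..n}" "\<lambda>k. p n k (\<omega> n)"] p0 that \<omega>_g[of n] g_less[OF \<omega>, of n n] \<epsilon> by simp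
  have "C * of_bool (\<omega> n (t k) \<notin> K k) < C" "C * J n (t k) (t k + h k) (\<omega> n) < C"
      "e k / c k * J n 0 (real k) (\<omega> n) < C" if "k \<le> n" for n k
  proof -
    have "0 \<le> C * of_bool (\<omega> n (t k) \<notin> K k)" "0 \<le> C * J n (t k) (t k + h k) (\<omega> n)"
      "0 \<le> e k / c k * J n 0 (real k) (\<omega> n)"
      using C e[of k] c(1)[of k] J0 by (auto intro!: mult_nonneg_nonneg)
    then show "C * of_bool (\<omega> n (t k) \<notin> K k) < C" "C * J n (t k) (t k + h k) (\<omega> n) < C"
      "e k / c k * J n 0 (real k) (\<omega> n) < C"
      using p_less[OF that] unfolding p_def by linarith+
  qed
  note pen = this
  have \<omega>_K: "\<omega> n (t k) \<in> K k" if "k \<le> n" for n k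
    using pen(1)[OF that] by (rule contrapos_pp) simp
  have \<omega>_right: "jumps (\<omega> n) (sorted_list_of_set (t ` {..n} \<inter> {t k..t k + h k})) = 0" if "k \<le> n" for n k
    using pen(2)[OF that] C by (simp add: J_def)
  have \<omega>_jumps: "real (jumps (\<omega> n) (sorted_list_of_set (t ` {..n} \<inter> {0..real k}))) < C * c k / e k"
    if "k \<le> n" for n k
    using pen(3)[OF that] c(1)[of k] e[of k] by (simp add: J_def field_simps)

  \<comment> \<open>The diagonal limit on the countable time set\<close>
  obtain r x where r: "strict_mono r" and x: "\<And>k. eventually (\<lambda>m. \<omega> (r m) (t k) = x k) sequentially"
    using eventually_constant_subsequence[of K "\<lambda>n k. \<omega> n (t k)"] K(1) \<omega>_K by metis
  \<comment> \<open>Passes from limits indexed by \<open>k\<close> to a function of time; every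
    index of \<open>s\<close> has the same eventual value.\<close>
  define y where "y s = x (SOME k. t k = s)" for s
  have y: "eventually (\<lambda>m. \<omega> (r m) s = y s) sequentially" if "s \<in> T" for s
  proof -
    have "t (SOME k. t k = s) = s" using that t by (intro someI_ex[of "\<lambda>k. t k = s"]) auto
    then show ?thesis using x[of "SOME k. t k = s"] by (simp add: y_def)
  qed
  have y_fin: "eventually (\<lambda>m. \<forall>s\<in>S. \<omega> (r m) s = y s) sequentially" if "finite S" "S \<subseteq> T" for S
    using that y by (intro eventually_ball_finite) auto
  have r_ge: "eventually (\<lambda>m. k \<le> r m) sequentially" for k
    using filterlim_subseq[OF r] by (simp add: filterlim_at_top)
  have in_range: "eventually (\<lambda>m. S \<subseteq> t ` {..r m}) sequentially" if S: "finite S" "S \<subseteq> T" for S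
  proof -
    have "eventually (\<lambda>m. \<forall>s\<in>S. s \<in> t ` {..r m}) sequentially"
    proof (intro eventually_ball_finite S(1) ballI)
      fix s assume "s \<in> S"
      then obtain k where "s = t k" using S(2) t by blast
      then show "eventually (\<lambda>m. s \<in> t ` {..r m}) sequentially"
        using r_ge[of k] by (auto elim!: eventually_mono)
    qed
    then show ?thesis by (simp only: subset_eq)
  qed
  \<comment> \<open>Everything about \<open>y\<close> is read off from one path: at a late enough
    stage it agrees with \<open>y\<close> on the finite set \<open>S\<close>, all of
    \<open>S\<close> has been enumerated, and the penalties with index \<open>k\<close> are in
    force.\<close>
  have stage: "\<exists>m. k \<le> r m \<and> (\<forall>s\<in>S. \<omega> (r m) s = y s) \<and> S \<subseteq> t ` {..r m}"
    if "finite S" "S \<subseteq> T" for S k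
  proof -
    have "eventually (\<lambda>m. k \<le> r m \<and> (\<forall>s\<in>S. \<omega> (r m) s = y s) \<and> S \<subseteq> t ` {..r m}) sequentially"
      using r_ge[of k] y_fin[OF that] in_range[OF that] by (intro eventually_conj)
    then show ?thesis by (rule eventually_happens'[OF sequentially_bot])
  qed

  \<comment> \<open>Extension to a cadlag path and the contradiction\<close>
  obtain \<omega>' where \<omega>': "\<omega>' \<in> paths" "\<And>s. s \<in> T \<Longrightarrow> \<omega>' s = y s"
  proof (rule cadlag_extension[of T y X])
    show "T \<subseteq> {0..}" by (rule T(3))
    show "T \<inter> {a<..<b} \<noteq> {}" if "0 \<le> a" "a < b" for a b using that by (rule T_dense)
    show "y s \<in> X" if s: "s \<in> T" for s
    proof -
      obtain m where "\<omega> (r m) s = y s" using stage[of "{s}" 0] s by blast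
      moreover have "\<omega> (r m) s \<in> X" using \<omega>[of "r m"] s T(3) by (auto simp: cadlag_paths_def)
      ultimately show ?thesis by simp
    qed
    show "\<exists>h>0. \<forall>u \<in> T \<inter> {s..s + h}. y u = y s" if s: "s \<in> T" for s
    proof -
      obtain k where k: "s = t k" using s t by blast
      have "y u = y s" if u: "u \<in> T \<inter> {s..s + h k}" for u
      proof (cases "u = s")
        case False
        have "finite {s, u}" "{s, u} \<subseteq> T" using s u by auto
        from stage[OF this, of k] obtain m where m: "k \<le> r m"
          "\<forall>v\<in>{s, u}. \<omega> (r m) v = y v" "{s, u} \<subseteq> t ` {..r m}" by blast
        \<comment> \<open>The pair is a sorted sublist of the enumerated times in an interval on
          which the penalty at \<open>t k\<close> has excluded all jumps.\<close>
        have "jumps (\<omega> (r m)) [s, u]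
            \<le> jumps (\<omega> (r m)) (sorted_list_of_set (t ` {..r m} \<inter> {t k..t k + h k}))"
          using m u False h(1)[of k] by (intro jumps_mono) (auto simp: k)
        then have "\<omega> (r m) s = \<omega> (r m) u" by (simp add: \<omega>_right[OF m(1)])
        then show ?thesis using m(2) by simp
      qed simp
      then show ?thesis using h(1)[of k] by blast
    qed
    show "\<exists>B. \<forall>l. set l \<subseteq> T \<inter> {0..real k} \<longrightarrow> sorted_wrt (<) l \<longrightarrow> jumps y l \<le> B" for k
    proof (intro exI allI impI)
      fix l assume l: "set l \<subseteq> T \<inter> {0..real k}" "sorted_wrt (<) l"
      obtain m where m: "k \<le> r m" "\<forall>v\<in>set l. \<omega> (r m) v = y v" "set l \<subseteq> t ` {..r m}"
        using stage[OF finite_set, of l k] l by blast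
      have "jumps y l = jumps (\<omega> (r m)) l" using m(2) by (intro jumps_cong) simp
      also have "\<dots> \<le> jumps (\<omega> (r m)) (sorted_list_of_set (t ` {..r m} \<inter> {0..real k}))"
        using m(3) l by (intro jumps_mono) auto
      \<comment> \<open>This bound is independent of the stage \<open>m\<close>, which varies with
        \<open>l\<close>.\<close>
      also have "\<dots> \<le> nat \<lceil>C * c k / e k\<rceil>"
        using \<omega>_jumps[OF m(1)] by linarith
      finally show "jumps y l \<le> nat \<lceil>C * c k / e k\<rceil>" .
    qed
  qed (rule that)
  have "\<epsilon> / 4 \<le> g n \<omega>'" for n
  proof -
    have "U n \<subseteq> T" by (auto simp: T_def)
    then obtain m where m: "n \<le> r m" "\<forall>v\<in>U n. \<omega> (r m) v = y v"
      using stage[of "U n" n] U(1) by blast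
    \<comment> \<open>Monotonicity trades \<open>g (r m)\<close> for the fixed \<open>g n\<close>,
      which sees only the times in \<open>U n\<close>, where \<open>\<omega> (r m)\<close> already
      agrees with \<open>\<omega>'\<close>.\<close>
    have "\<epsilon> / 4 \<le> g (r m) (\<omega> (r m))" using g_\<omega> less_imp_le by blast
    also have "\<dots> \<le> g n (\<omega> (r m))" using decseqD[OF dec[OF \<omega>] m(1)] .
    also have "\<dots> = g n \<omega>'" 
    proof (intro g_eq \<omega> \<omega>'(1) ballI)
      fix v assume "v \<in> U n"
      then show "\<omega> (r m) v = \<omega>' v" using m(2) \<omega>'(2) \<open>U n \<subseteq> T\<close> by (simp add: subset_iff)
    qed
    finally show ?thesis .
  qed
  then have "\<epsilon> / 4 \<le> 0" using LIMSEQ_le_const[OF lim[OF \<omega>'(1)]] by blast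
  then show False using \<epsilon> by simp
qed

text \<open>Isotonicity gives \<open>E f \<le> E (F n)\<close>, and subadditivity bounds the gap by
  the upper expectation of \<open>F n - f\<close>, which decreases pointwise to zero.\<close>

lemma downward_continuous: "downward_continuous paths (finitary_funs X) E"
  unfolding downward_continuous_def
proof (intro allI impI, elim conjE)
  fix F f
  assume F: "\<forall>n. F n \<in> finitary_funs X" and f: "f \<in> finitary_funs X"
    and dl: "\<forall>\<omega>\<in>paths. decseq (\<lambda>n. F n \<omega>) \<and> (\<lambda>n. F n \<omega>) \<longlonglongrightarrow> f \<omega>"
  have restr: "restrict k paths = k" if "k \<in> finitary_funs X" for k
    using that linear_space_finitary_funs[of X]
    by (auto simp: linear_space_with_constants_def intro!: extensional_restrict)
  have fin: "finitary (F n)" "finitary f" for n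
    using F f restr by (simp_all add: finitary_def)
  have UE: "UE (F n) = E (F n)" "UE f = E f" for n
    using F f restr by (simp_all add: UE_def)
  let ?g = "\<lambda>n \<omega>. F n \<omega> + (- 1) * f \<omega>"
  have g: "finitary (?g n)" for n by (intro finitary_add finitary_scale fin)
  have up: "E (F n) \<le> E f + UE (?g n)" for n
    using UE_add[OF fin(2) g, of n] UE by (simp add: UE_def)
  have low: "E f \<le> E (F n)" for n
    using UE_mono[OF fin(2) fin(1), of n] UE dl by (metis decseq_ge)
  have F_mono: "E (F m) \<le> E (F n)" if "n \<le> m" for n m
    using UE_mono[OF fin(1) fin(1), of m n] UE dl that by (metis decseqD)
  show "(\<lambda>n. E (F n)) \<longlonglongrightarrow> E f"
  proof (rule LIMSEQ_I)
    fix \<epsilon> :: real assume \<epsilon>: "0 < \<epsilon>"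
    have "\<exists>n. UE (?g n) < \<epsilon>"
    proof (rule UE_decreasing_to_zero[OF g _ _ \<epsilon>])
      fix \<omega> assume \<omega>: "\<omega> \<in> paths"
      show "decseq (\<lambda>n. ?g n \<omega>)" using dl \<omega> by (auto simp: decseq_def)
      show "(\<lambda>n. ?g n \<omega>) \<longlonglongrightarrow> 0"
        using tendsto_diff[OF bspec[OF dl \<omega>, THEN conjunct2] tendsto_const[of "f \<omega>"]] by simp
    qed
    then obtain N where N: "UE (?g N) < \<epsilon>" ..
    have "norm (E (F n) - E f) < \<epsilon>" if "N \<le> n" for n
      using low[of n] F_mono[OF that] up[of N] N by simp
    then show "\<exists>N. \<forall>n\<ge>N. norm (E (F n) - E f) < \<epsilon>" by blast
  qed
qed

end

text \<open>What remains is to translate the assumptions on \<open>EU\<close> into the two locale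
  properties: \<open>UE_neq_le\<close> yields \<open>lipschitz\<close>, and an exhaustion of
  \<open>X\<close> by finite sets yields \<open>tight\<close>.\<close>

theorem theorem7:
  fixes X :: "'x set"
    and EU :: "real set \<Rightarrow> ((real \<Rightarrow> 'x) \<Rightarrow> real) \<Rightarrow> real"
    and E :: "((real \<Rightarrow> 'x) \<Rightarrow> real) \<Rightarrow> real"
  assumes "countable X" and "X \<noteq> {}"
    and "fd_upper_expectations X EU"
    and "consistent X EU"
    and "\<forall>U\<in>time_sets. downward_continuous (U \<rightarrow>\<^sub>E X) (bounded_funs (U \<rightarrow>\<^sub>E X)) (EU U)"
    and "\<forall>n::nat. \<exists>c\<ge>0::real. \<forall>t\<in>{0..real n}.
           Limsup (at t within {0..})
             (\<lambda>s. ereal (EU {s, t} (neq_indicator X s t) / \<bar>s - t\<bar>)) \<le> ereal c"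
    and "corresponding_upper_expectation X EU E"
  shows "downward_continuous (cadlag_paths X) (finitary_funs X) E"
proof -
  interpret upper_process X E
    using assms(7) by unfold_locales (simp add: corresponding_upper_expectation_def)
  have E: "UE (\<lambda>\<omega>. f (restrict \<omega> U)) = EU U f"
    if "U \<in> time_sets" "f \<in> bounded_funs (U \<rightarrow>\<^sub>E X)" for U f
    using assms(7) that unfolding corresponding_upper_expectation_def by (simp add: UE_def compose_def)
  have bounded: "(\<lambda>x\<in>U \<rightarrow>\<^sub>E X. of_bool (P x)) \<in> bounded_funs (U \<rightarrow>\<^sub>E X)" for U P
    by (auto simp: bounded_funs_def bounded_iff intro!: exI[of _ 1])
  have path_in: "\<omega> t \<in> X" if "\<omega> \<in> cadlag_paths X" "0 \<le> t" for \<omega> t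
    using that by (auto simp: cadlag_paths_def)
  have neq: "UE (\<lambda>\<omega>. of_bool (\<omega> s \<noteq> \<omega> t)) = EU {s, t} (neq_indicator X s t)"
    if "0 \<le> s" "0 \<le> t" for s t
  proof -
    have st: "{s, t} \<in> time_sets" using that by (simp add: time_sets_def)
    have eq: "neq_indicator X s t = (\<lambda>x\<in>{s, t} \<rightarrow>\<^sub>E X. of_bool (x s \<noteq> x t))"
      by (simp add: neq_indicator_def of_bool_def)
    have "EU {s, t} (neq_indicator X s t) = UE (\<lambda>\<omega>. neq_indicator X s t (restrict \<omega> {s, t}))"
      unfolding eq by (rule E[OF st bounded, symmetric])
    also have "\<dots> = UE (\<lambda>\<omega>. of_bool (\<omega> s \<noteq> \<omega> t))"
      unfolding UE_def
      by (rule arg_cong[of _ _ E], rule restrict_ext) (use path_in that in \<open>simp add: eq\<close>)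
    finally show ?thesis by simp
  qed
  interpret tight_lipschitz_process X E
  proof
    fix n :: nat
    obtain c where c: "c \<ge> 0" "\<forall>t\<in>{0..real n}. Limsup (at t within {0..})
        (\<lambda>s. ereal (EU {s, t} (neq_indicator X s t) / \<bar>s - t\<bar>)) \<le> ereal c"
      using assms(6) by blast
    have "Limsup (at t within {0..}) (\<lambda>s. ereal (UE (\<lambda>\<omega>. of_bool (\<omega> s \<noteq> \<omega> t)) / \<bar>s - t\<bar>)) \<le> ereal c"
      if t: "t \<in> {0..real n}" for t
    proof -
      \<comment> \<open>The quotients agree at all \<open>s \<ge> 0\<close>, so any radius serves as
        the witness.\<close>
      have "eventually (\<lambda>s. ereal (UE (\<lambda>\<omega>. of_bool (\<omega> s \<noteq> \<omega> t)) / \<bar>s - t\<bar>)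
          = ereal (EU {s, t} (neq_indicator X s t) / \<bar>s - t\<bar>)) (at t within {0..})"
        using t neq by (auto simp: eventually_at intro!: exI[of _ 1])
      from Limsup_eq[OF this] show ?thesis using c(2)[rule_format, OF t] by (rule ord_eq_le_trans)
    qed
    then have "UE (\<lambda>\<omega>. of_bool (\<omega> s \<noteq> \<omega> t)) \<le> (c + 1) * (t - s)"
      if "0 \<le> s" "s \<le> t" "t \<le> real n" for s t
      using UE_neq_le that by blast
    moreover have "c + 1 \<ge> 0" using c(1) by simp
    ultimately show "\<exists>L\<ge>0. \<forall>s t. 0 \<le> s \<longrightarrow> s \<le> t \<longrightarrow> t \<le> real n \<longrightarrow>
        UE (\<lambda>\<omega>. of_bool (\<omega> s \<noteq> \<omega> t)) \<le> L * (t - s)" by blast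
  next
    fix t \<eta> :: real assume t: "0 \<le> t" and \<eta>: "0 < \<eta>"
    have ts: "{t} \<in> time_sets" using t by (simp add: time_sets_def)
    \<comment> \<open>By countability each state lies in \<open>?K j\<close> for all large
      \<open>j\<close>, so the indicators of being outside decrease to zero and downward continuity
      of \<open>EU {t}\<close> applies.\<close>
    let ?K = "\<lambda>j::nat. from_nat_into X ` {..<j}"
    let ?F = "\<lambda>j. \<lambda>x\<in>{t} \<rightarrow>\<^sub>E X. of_bool (x t \<notin> ?K j) :: real"
    have "(\<lambda>j. EU {t} (?F j)) \<longlonglongrightarrow> EU {t} (\<lambda>x\<in>{t} \<rightarrow>\<^sub>E X. 0)"
    proof (rule bspec[OF assms(5) ts, unfolded downward_continuous_def, rule_format], intro conjI allI ballI)
      show "?F j \<in> bounded_funs ({t} \<rightarrow>\<^sub>E X)" for j by (rule bounded)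
      show "(\<lambda>x\<in>{t} \<rightarrow>\<^sub>E X. 0) \<in> bounded_funs ({t} \<rightarrow>\<^sub>E X)"
        by (auto simp: bounded_funs_def bounded_iff)
    next
      fix x assume x: "x \<in> {t} \<rightarrow>\<^sub>E X"
      show "decseq (\<lambda>j. ?F j x)" using x by (auto simp: decseq_def)
      have "x t \<in> X" using x by auto
      then obtain i where i: "from_nat_into X i = x t" using from_nat_into_surj[OF assms(1)] by blast
      have "?F j x = 0" if "j > i" for j using x i that by force
      then have "eventually (\<lambda>j. ?F j x = 0) sequentially"
        unfolding eventually_sequentially by (intro exI[of _ "Suc i"]) auto
      then show "(\<lambda>j. ?F j x) \<longlonglongrightarrow> (\<lambda>x\<in>{t} \<rightarrow>\<^sub>E X. 0) x"
        using x by (simp add: tendsto_eventually)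
    qed
    moreover have "EU {t} (\<lambda>x\<in>{t} \<rightarrow>\<^sub>E X. 0) = 0"
      using assms(3) ts by (simp add: fd_upper_expectations_def upper_expectation_def)
    ultimately have "eventually (\<lambda>j. EU {t} (?F j) < \<eta>) sequentially"
      using \<eta> by (simp add: order_tendstoD(2))
    then obtain j where j: "EU {t} (?F j) < \<eta>"
      using eventually_happens'[OF sequentially_bot] by blast
    have "UE (\<lambda>\<omega>. of_bool (\<omega> t \<notin> ?K j)) = UE (\<lambda>\<omega>. ?F j (restrict \<omega> {t}))"
      unfolding UE_def
      by (rule arg_cong[of _ _ E], rule restrict_ext) (use path_in t in simp)
    also have "\<dots> = EU {t} (?F j)" by (rule E[OF ts bounded])
    finally show "\<exists>K. finite K \<and> UE (\<lambda>\<omega>. of_bool (\<omega> t \<notin> K)) \<le> \<eta>"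
      using j by (intro exI[of _ "?K j"]) simp
  qed
  show ?thesis by (rule downward_continuous)
qed

end
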